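(* Let $k>1$ be real, let $\Psi(u)=1-(1-u)^k$ for $u\in[0,1]$, and let $F=F^\Psi$. Then, as $x\to\infty$, $$1-F(x)\sim\frac{c_k}{x^{1/(k-1)}}\qquad\text{and}\qquad F'(x)\sim\frac{c_k}{(k-1)\,x^{1+1/(k-1)}},$$ where $c_k=\left(\dfrac{2k-1}{k(k-1)}\right)^{1/(k-1)}$.
   Context: $L^1_{\mathrm{loc}}$ is the space of locally integrable functions $[0,\infty)\to\mathbb R$ with its usual topology ($L^1$ convergence on compacts). $\mathcal D\subset L^1_{\mathrm{loc}}$ is the set of nondecreasing càdlàg functions $F:[0,\infty]\to[0,1]$. For $f\in L^1_{\mathrm{loc}}$ let $\|f\|_{x^{-2}}=\int_0^\infty x^{-2}|f(x)|\,dx\in[0,\infty]$, and $\mathcal D_1=\{F\in\mathcal D:\|F\|_{x^{-2}}\le1\}$. A "distribution function" is the cumulative distribution function of a probability measure (here on $[0,\infty)$). A family $\{F_\alpha\}$ of distribution functions on $[0,\infty)$ is tight if for every $\epsilon>0$ there is $N$ with $F_\alpha(N)>1-\epsilon$ for all $\alpha$. $\mathcal X$ (resp. $\mathcal X_1$) is the set of Borel measurable maps $\mathbf F=(\mathbf F_t)_{t\ge0}$ from $[0,\infty)$ to $\mathcal D$ (resp. $\mathcal D_1$). For $\mathbf F\in\mathcal X$, $$\mathscr S^\Psi(\mathbf F)_t(x)=\mathbf F_0(e^{-t}x)+\int_0^t(e^{s-t}x)^2\Big[\int_{e^{s-t}x}^\infty\frac1z\,d\Psi(\mathbf F_s(z))\Big]ds,$$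 where $\int_y^\infty$ is over $(y,\infty)$ and $d\Psi(\mathbf F_s(z))$ is the Lebesgue–Stieltjes measure of $z\mapsto\Psi(\mathbf F_s(z))$. Set $$\mathfrak F=\{\mathbf F\in\mathcal X_1:\ \mathbf F=\mathscr S^\Psi(\mathbf F),\ \mathbf F_t(+\infty)=1\ \forall t\ge0,\ \{\mathbf F_t\}_{t\ge0}\text{ tight}\}.$$ For $\Psi$ continuous with $1-\Psi(u)\ge c(1-u)^{\kappa}$ on $(0,1)$ for some $c>0,\kappa\ge1$ (which holds here), $\mathfrak F\ne\emptyset$ and $F^\Psi$ denotes the unique distribution function in $\mathcal D_1$ such that $\|\mathbf F_t-F^\Psi\|_{x^{-2}}\le2e^{-t}$ for all $t\ge0$ and all $\mathbf F\in\mathfrak F$. It is continuously differentiable, satisfies $(F^\Psi)'(x)=x\int_x^\infty\frac1z\,d\Psi(F^\Psi(z))$ for all $x\ge0$, and $\|F^\Psi\|_{x^{-2}}=1$. The notation $f\sim g$ means $f/g\to1$. *)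

theory Defs
  imports "HOL-Probability.Probability" "HOL-Library.Landau_Symbols"
begin

text \<open>
  A function on \<open>[0,\<infinity>)\<close> is represented by its extension to \<^typ>\<open>real\<close> that vanishes on the
  negative half-line. For members of \<open>cadlag_D\<close> below this makes the representation unique
  and lets \<^const>\<open>interval_measure\<close> be used for Lebesgue--Stieltjes measures.
  Elements of \<open>L1loc\<close> are functions rather than classes modulo null sets, so \<open>L1loc_topology\<close>
  is not Hausdorff; its subspace topology on \<open>cadlag_D\<close> is, since an a.e.-class
  contains at most one right-continuous function.
\<close>

definition L1loc :: "(real \<Rightarrow> real) set" where
  "L1loc = {f. (\<forall>x<0. f x = 0) \<and> (\<forall>N. set_integrable lborel {0..N} f)}"

definition L1loc_topology :: "(real \<Rightarrow> real) topology" where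
  "L1loc_topology = topology_generated_by
     {{g \<in> L1loc. (LINT x:{0..N}|lborel. \<bar>g x - f x\<bar>) < e} | f N e. f \<in> L1loc \<and> 0 < e}"

text \<open>
  Being elements of \<open>L1loc\<close>, members of \<open>cadlag_D\<close> carry no independent value at \<open>+\<infinity>\<close>:
  \<open>F(+\<infinity>)\<close> is the limit of \<open>F\<close> at \<^const>\<open>at_top\<close>.
\<close>

definition cadlag_D :: "(real \<Rightarrow> real) set" where
  "cadlag_D = {F \<in> L1loc.
     mono_on {0..} F \<and>
     (\<forall>x\<ge>0. F x \<in> {0..1}) \<and>
     (\<forall>x\<ge>0. continuous (at_right x) F) \<and>
     (\<forall>x>0. \<exists>l. (F \<longlongrightarrow> l) (at_left x))}"

definition wnorm :: "(real \<Rightarrow> real) \<Rightarrow> ennreal" where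
  "wnorm f = (\<integral>\<^sup>+x\<in>{0<..}. ennreal (\<bar>f x\<bar> / x\<^sup>2) \<partial>lborel)"

definition cadlag_D1 :: "(real \<Rightarrow> real) set" where
  "cadlag_D1 = {F \<in> cadlag_D. wnorm F \<le> 1}"

definition distribution_function :: "(real \<Rightarrow> real) \<Rightarrow> bool" where
  "distribution_function F \<longleftrightarrow>
     (\<exists>M. real_distribution M \<and> measure M {..<0} = 0 \<and> F = cdf M)"

definition tight_family :: "'i set \<Rightarrow> ('i \<Rightarrow> real \<Rightarrow> real) \<Rightarrow> bool" where
  "tight_family I F \<longleftrightarrow> (\<forall>e>0. \<exists>N. \<forall>i\<in>I. F i N > 1 - e)"

text \<open>
  The Borel measurable maps from \<open>[0,\<infinity>)\<close> to a subspace \<open>A\<close> of \<open>L1loc\<close>; their values at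
  negative times are irrelevant.
\<close>

definition borel_paths :: "(real \<Rightarrow> real) set \<Rightarrow> (real \<Rightarrow> real \<Rightarrow> real) set" where
  "borel_paths A =
     restrict_space borel {0..} \<rightarrow>\<^sub>M sigma A {U. openin (subtopology L1loc_topology A) U}"

text \<open>
  For \<open>x > 0\<close> the inner integrand is bounded by \<open>1 / y\<close> with \<open>y = exp (s - t) * x\<close> and the
  Stieltjes measure is finite, so the inner integral is finite. At \<open>x = 0\<close> the vanishing factor
  makes the second summand 0, the limit as \<open>x\<close> tends to 0 from the right.
\<close>

definition evolution ::
  "(real \<Rightarrow> real) \<Rightarrow> (real \<Rightarrow> real \<Rightarrow> real) \<Rightarrow> real \<Rightarrow> real \<Rightarrow> real" where
  "evolution \<Psi> F t x =
     F 0 (exp (- t) * x) +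
     (LINT s:{0..t}|lborel.
        (exp (s - t) * x)\<^sup>2 *
        (LINT z:{exp (s - t) * x<..}|interval_measure (\<lambda>z. \<Psi> (F s z)). 1 / z))"

definition evolution_solutions :: "(real \<Rightarrow> real) \<Rightarrow> (real \<Rightarrow> real \<Rightarrow> real) set" where
  "evolution_solutions \<Psi> = {F \<in> borel_paths cadlag_D1.
     (\<forall>t\<ge>0. \<forall>x\<ge>0. F t x = evolution \<Psi> F t x) \<and>
     (\<forall>t\<ge>0. (F t \<longlongrightarrow> 1) at_top) \<and>
     tight_family {0..} F}"

definition attracting_profile :: "(real \<Rightarrow> real) \<Rightarrow> (real \<Rightarrow> real) \<Rightarrow> bool" where
  "attracting_profile \<Psi> G \<longleftrightarrow>
     G \<in> cadlag_D1 \<and> distribution_function G \<and>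
     (\<forall>F\<in>evolution_solutions \<Psi>. \<forall>t\<ge>0. wnorm (\<lambda>x. F t x - G x) \<le> ennreal (2 * exp (- t)))"

text \<open>\<open>is_F_Psi \<Psi> F\<close> says that \<open>F\<close> is the distribution function \<open>F\<^sup>\<Psi>\<close>.\<close>

definition is_F_Psi :: "(real \<Rightarrow> real) \<Rightarrow> (real \<Rightarrow> real) \<Rightarrow> bool" where
  "is_F_Psi \<Psi> F \<longleftrightarrow>
     attracting_profile \<Psi> F \<and> (\<forall>G. attracting_profile \<Psi> G \<longrightarrow> G = F)"

end

theory Submission
  imports Defs
begin

text \<open>
  Write \<open>G = 1 - F\<close>. The profile solves \<open>F' x = x * (\<integral> z > x. 1 / z d\<Psi>(F z))\<close>. Since
  \<open>1 - \<Psi> (F z) = G z powr k\<close>, integrating by parts in the Stieltjes integral turns this into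
  \<open>F' x = G x powr k - x * J x\<close> with \<open>J x = (\<integral> w > x. G w powr k / w\<^sup>2 dw)\<close>; the right-hand side
  is called the flux of \<open>G powr k\<close>. Everything about the tail of \<open>G\<close> follows from this equation.

  \<^emph>\<open>The equation.\<close> The definition of the profile says only that it attracts every solution
  \<open>X\<close> of the evolution equation, and that it is unique in doing so. If there were no solution, then
  every distribution function in \<open>cadlag_D1\<close> would be attracting; uniqueness therefore supplies a
  solution. Along the characteristic \<open>s \<mapsto> exp s * x\<close> the evolution equation says that the increment
  of \<open>X\<close> over the time interval from \<open>t\<close> to \<open>t + h\<close> is the integral of
  \<open>exp s * x * flux (V (t + s)) (exp s * x)\<close> over \<open>{0..h}\<close>, where \<open>V = (1 - X) powr k\<close>. A flux lies
  between 0 and 1, so the limit \<open>F\<close> of \<open>X t\<close> is continuous on the positive half-line,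
  \<open>X t\<close> converges to \<open>F\<close> pointwise there because the functions are monotone, and dominated
  convergence lets \<open>t\<close> tend to infinity in the increment (\<open>F_increment\<close>). Differentiating in \<open>h\<close>
  gives the equation (\<open>DERIV_F\<close>).

  \<^emph>\<open>The tail.\<close> Let \<open>f = F'\<close>. Two quantities are followed: \<open>p = x * G powr (k - 1)\<close>, whose limit
  \<open>L = (2 * k - 1) / (k * (k - 1))\<close> is the first claim, and \<open>R = f / (x * G powr (2 * k - 1))\<close>.
  With \<open>G\<close> as the independent variable the equation is the pair
  \<open>d(f / x) / dG = k * G powr (k - 1) / x\<close> and \<open>d(x\<^sup>2) / dG = - 2 * x / f\<close>.
  Both halves can be integrated with inequalities: if \<open>p \<le> P\<close> eventually, the first gives
  \<open>R \<ge> k / ((2 * k - 1) * P)\<close>, and then the second gives \<open>p\<^sup>2 \<le> L * P + e\<close> for every \<open>e > 0\<close>; the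
  same holds with all inequalities reversed. So the upper limit \<open>S\<close> of \<open>p\<close> satisfies
  \<open>S\<^sup>2 \<le> L * S\<close> and the lower limit satisfies \<open>S\<^sup>2 \<ge> L * S\<close>: the iteration \<open>P \<mapsto> sqrt (L * P)\<close> squeezes both
  to its fixed point \<open>L\<close> (\<open>tendsto_of_sqrt_contraction\<close>), as soon as \<open>p\<close> is known to stay between
  positive constants. Those a priori bounds come from
  \<open>G powr k - G / x \<le> f \<le> G powr k\<close> (\<open>p_lower\<close>, \<open>p_upper\<close>). Finally the limit of \<open>R\<close> follows from that
  of \<open>p\<close>, and \<open>x * f / G = R * p\<^sup>2\<close> tends to \<open>1 / (k - 1)\<close>, which is the second claim.
\<close>

section \<open>The flux of a survival function\<close>

text \<open>
  For \<open>y > 0\<close> and a survival function \<open>V\<close> this equals \<open>y * (\<integral> z > y. 1 / z d(1 - V z))\<close>, integrated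
  by parts; see \<open>stieltjes_tail_eq_flux\<close>. In this form pointwise limits of \<open>V\<close> can be taken without
  discussing convergence of Stieltjes measures.
\<close>

definition flux :: "(real \<Rightarrow> real) \<Rightarrow> real \<Rightarrow> real" where
  "flux V y = V y - y * (LINT w:{y<..}|lborel. V w / w\<^sup>2)"

lemma has_bochner_integral_inverse_square:
  fixes y :: real
  assumes y: "0 < y"
  shows "has_bochner_integral lborel (\<lambda>w. indicator {y<..} w * (1 / w\<^sup>2)) (1 / y)"
proof (rule has_bochner_integral_nn_integral)
  have "(\<integral>\<^sup>+w. ennreal (1 / w\<^sup>2) * indicator {y..} w \<partial>lborel) = ennreal (0 - (- 1 / y))"
  proof (rule nn_integral_FTC_atLeast)
    show "((\<lambda>w. - 1 / w) has_real_derivative 1 / w\<^sup>2) (at w)" if "y \<le> w" for w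
      using y that by (auto intro!: derivative_eq_intros simp: power2_eq_square)
    have "(\<lambda>w. - 1 / w) = (\<lambda>w::real. - inverse w)" by (simp add: fun_eq_iff divide_inverse)
    then show "((\<lambda>w::real. - 1 / w) \<longlongrightarrow> 0) at_top"
      using tendsto_minus[OF tendsto_inverse_0_at_top[OF filterlim_ident]] by (simp only: minus_zero)
  qed auto
  also have "(\<integral>\<^sup>+w. ennreal (1 / w\<^sup>2) * indicator {y..} w \<partial>lborel) =
      (\<integral>\<^sup>+w. ennreal (indicator {y<..} w * (1 / w\<^sup>2)) \<partial>lborel)"
    by (intro nn_integral_cong_AE, use AE_lborel_singleton[of y] in eventually_elim)
       (auto simp: indicator_def)
  finally show "(\<integral>\<^sup>+w. ennreal (indicator {y<..} w * (1 / w\<^sup>2)) \<partial>lborel) = ennreal (1 / y)" by simp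
qed (use y in \<open>auto simp: indicator_def\<close>)

lemma inverse_square_tail:
  fixes y :: real
  assumes "0 < y"
  shows "set_integrable lborel {y<..} (\<lambda>w. c / w\<^sup>2)" and "(LINT w:{y<..}|lborel. c / w\<^sup>2) = c / y"
  using has_bochner_integral_mult_right[OF has_bochner_integral_inverse_square[OF assms], of c]
  by (auto simp: set_integrable_def set_lebesgue_integral_def has_bochner_integral_iff mult.commute)

text \<open>
  The functions \<open>(1 - H) powr k\<close> with \<open>H\<close> in \<open>cadlag_D\<close> are of this kind.
\<close>

locale survival =
  fixes V :: "real \<Rightarrow> real"
  assumes antimono: "x \<le> y \<Longrightarrow> V y \<le> V x"
    and bounds: "0 \<le> V x" "V x \<le> 1"
begin

lemma borel_measurable_V[measurable]: "V \<in> borel_measurable borel"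
proof -
  have "(\<lambda>x. - V x) \<in> borel_measurable borel"
    by (rule borel_measurable_mono) (auto simp: mono_def antimono)
  then show ?thesis by simp
qed

lemma tail_integrable:
  assumes "0 < y" shows "set_integrable lborel {y<..} (\<lambda>w. V w / w\<^sup>2)"
proof (rule set_integrable_bound[OF inverse_square_tail(1)[OF assms]])
  show "set_borel_measurable lborel {y<..} (\<lambda>w. V w / w\<^sup>2)"
    unfolding set_borel_measurable_def by simp
  show "AE w in lborel. w \<in> {y<..} \<longrightarrow> norm (V w / w\<^sup>2) \<le> norm (1 / w\<^sup>2)"
    using bounds by (auto intro!: AE_I2 divide_right_mono)
qed

lemma tail_bounds:
  assumes y: "0 < y"
  shows "0 \<le> (LINT w:{y<..}|lborel. V w / w\<^sup>2)" and "y * (LINT w:{y<..}|lborel. V w / w\<^sup>2) \<le> V y"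
proof -
  show "0 \<le> (LINT w:{y<..}|lborel. V w / w\<^sup>2)"
    unfolding set_lebesgue_integral_def using bounds by (intro integral_nonneg_AE) auto
  have "(LINT w:{y<..}|lborel. V w / w\<^sup>2) \<le> (LINT w:{y<..}|lborel. V y / w\<^sup>2)"
    using tail_integrable[OF y] inverse_square_tail(1)[OF y] antimono
    by (intro set_integral_mono) (auto intro!: divide_right_mono)
  also have "\<dots> = V y / y" using inverse_square_tail(2)[OF y] by simp
  finally show "y * (LINT w:{y<..}|lborel. V w / w\<^sup>2) \<le> V y" using y by (simp add: field_simps)
qed

lemma flux_bounds: "0 < y \<Longrightarrow> 0 \<le> flux V y \<and> flux V y \<le> V y"
  using tail_bounds[of y] by (simp add: flux_def)

text \<open>
  Insert \<open>1 / z = (\<integral> w \<ge> z. 1 / w\<^sup>2 dw)\<close> and exchange the two integrals: the inner one becomes the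
  measure of \<open>{y<..w}\<close>, which is \<open>V y - V w\<close>. All integrands are nonnegative, so Tonelli's theorem
  applies without integrability hypotheses.
\<close>

lemma stieltjes_tail_eq_flux:
  assumes right_cont: "\<And>x. continuous (at_right x) V" and y: "0 < y"
  shows "y * (LINT z:{y<..}|interval_measure (\<lambda>z. 1 - V z). 1 / z) = flux V y"
proof -
  let ?\<mu> = "interval_measure (\<lambda>z. 1 - V z)"
  have cont: "continuous (at_right x) (\<lambda>z. 1 - V z)" for x
    by (intro continuous_intros right_cont)
  interpret \<mu>: sigma_finite_measure ?\<mu>
    by (rule sigma_finite_interval_measure) (auto simp: antimono cont)
  interpret pair_sigma_finite ?\<mu> lborel ..
  have Ioc: "emeasure ?\<mu> {a<..b} = ennreal (V a - V b)" if "a \<le> b" for a b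
    using emeasure_interval_measure_Ioc[of a b "\<lambda>z. 1 - V z"] antimono cont that by simp
  have int: "integrable lborel (\<lambda>w. indicator {y<..} w * ((V y - V w) / w\<^sup>2))"
  proof -
    have "set_integrable lborel {y<..} (\<lambda>w. V y / w\<^sup>2 - V w / w\<^sup>2)"
      using inverse_square_tail(1)[OF y] tail_integrable[OF y] by (intro set_integral_diff) auto
    then show ?thesis by (simp add: set_integrable_def diff_divide_distrib)
  qed
  have "(\<integral>\<^sup>+z. ennreal (indicator {y<..} z * (1 / z)) \<partial>?\<mu>) =
      (\<integral>\<^sup>+z. \<integral>\<^sup>+w. ennreal (indicator {y<..} w * (1 / w\<^sup>2)) * indicator {y<..w} z \<partial>lborel \<partial>?\<mu>)"
  proof (rule nn_integral_cong)
    fix z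
    show "ennreal (indicator {y<..} z * (1 / z)) =
      (\<integral>\<^sup>+w. ennreal (indicator {y<..} w * (1 / w\<^sup>2)) * indicator {y<..w} z \<partial>lborel)"
    proof (cases "y < z")
      case True
      then have z: "0 < z" using y by simp
      have "(\<integral>\<^sup>+w. ennreal (indicator {y<..} w * (1 / w\<^sup>2)) * indicator {y<..w} z \<partial>lborel) =
        (\<integral>\<^sup>+w. ennreal (indicator {z<..} w * (1 / w\<^sup>2)) \<partial>lborel)"
        by (intro nn_integral_cong_AE, use AE_lborel_singleton[of z] in eventually_elim)
           (use True in \<open>auto simp: indicator_def\<close>)
      also have "\<dots> = ennreal (1 / z)"
        using has_bochner_integral_inverse_square[OF z]
        by (subst nn_integral_eq_integral) (auto simp: has_bochner_integral_iff indicator_def)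
      finally show ?thesis using True by simp
    qed simp
  qed
  also have "\<dots> = (\<integral>\<^sup>+w. \<integral>\<^sup>+z. ennreal (indicator {y<..} w * (1 / w\<^sup>2)) * indicator {y<..w} z \<partial>?\<mu> \<partial>lborel)"
    by (subst Fubini') (auto simp: greaterThanAtMost_def greaterThan_def atMost_def cong: measurable_cong_sets)
  also have "\<dots> = (\<integral>\<^sup>+w. ennreal (indicator {y<..} w * ((V y - V w) / w\<^sup>2)) \<partial>lborel)"
  proof (rule nn_integral_cong)
    fix w
    show "(\<integral>\<^sup>+z. ennreal (indicator {y<..} w * (1 / w\<^sup>2)) * indicator {y<..w} z \<partial>?\<mu>) =
      ennreal (indicator {y<..} w * ((V y - V w) / w\<^sup>2))"
      using Ioc[of y w] antimono[of y w]
      by (cases "y < w") (auto simp: nn_integral_cmult_indicator ennreal_mult'[symmetric])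
  qed
  finally have nn: "(\<integral>\<^sup>+z. ennreal (indicator {y<..} z * (1 / z)) \<partial>?\<mu>) =
    (\<integral>\<^sup>+w. ennreal (indicator {y<..} w * ((V y - V w) / w\<^sup>2)) \<partial>lborel)" .
  have "(LINT z:{y<..}|?\<mu>. 1 / z) = enn2real (\<integral>\<^sup>+z. ennreal (indicator {y<..} z * (1 / z)) \<partial>?\<mu>)"
    unfolding set_lebesgue_integral_def real_scaleR_def
    using y by (intro integral_eq_nn_integral) (auto simp: indicator_def cong: measurable_cong_sets)
  also have "\<dots> = (LINT w|lborel. indicator {y<..} w * ((V y - V w) / w\<^sup>2))"
    unfolding nn using antimono
    by (intro integral_eq_nn_integral[symmetric]) (auto simp: indicator_def)
  also have "\<dots> = (LINT w:{y<..}|lborel. V y / w\<^sup>2 - V w / w\<^sup>2)"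
    by (simp add: set_lebesgue_integral_def diff_divide_distrib)
  also have "\<dots> = V y / y - (LINT w:{y<..}|lborel. V w / w\<^sup>2)"
    using inverse_square_tail[OF y] tail_integrable[OF y] by (subst set_integral_diff) auto
  finally show ?thesis using y by (simp add: flux_def right_diff_distrib)
qed

end

lemma flux_tendsto:
  assumes V: "\<And>n. survival (V n)" "survival U" and y: "0 < y"
    and lim: "\<And>w. y \<le> w \<Longrightarrow> (\<lambda>n. V n w) \<longlonglongrightarrow> U w"
  shows "(\<lambda>n. flux (V n) y) \<longlonglongrightarrow> flux U y"
proof -
  note [measurable] = survival.borel_measurable_V[OF V(1)] survival.borel_measurable_V[OF V(2)]
  have "(\<lambda>n. LINT w:{y<..}|lborel. V n w / w\<^sup>2) \<longlonglongrightarrow> (LINT w:{y<..}|lborel. U w / w\<^sup>2)"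
    unfolding set_lebesgue_integral_def
  proof (rule integral_dominated_convergence)
    show "integrable lborel (\<lambda>w. indicator {y<..} w *\<^sub>R (1 / w\<^sup>2))"
      using inverse_square_tail(1)[OF y, of 1] by (simp add: set_integrable_def)
    show "AE w in lborel. (\<lambda>n. indicator {y<..} w *\<^sub>R (V n w / w\<^sup>2)) \<longlonglongrightarrow> indicator {y<..} w *\<^sub>R (U w / w\<^sup>2)"
    proof (rule AE_I2)
      fix w
      show "(\<lambda>n. indicator {y<..} w *\<^sub>R (V n w / w\<^sup>2)) \<longlonglongrightarrow> indicator {y<..} w *\<^sub>R (U w / w\<^sup>2)"
        using lim[of w] y by (cases "y < w") (auto intro!: tendsto_intros)
    qed
    show "AE w in lborel. norm (indicator {y<..} w *\<^sub>R (V n w / w\<^sup>2)) \<le> indicator {y<..} w *\<^sub>R (1 / w\<^sup>2)" for n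
      using survival.bounds[OF V(1), of n] by (auto simp: indicator_def intro!: AE_I2 divide_right_mono)
  qed auto
  then show ?thesis unfolding flux_def by (intro tendsto_intros lim order_refl)
qed

text \<open>
  Used in two ways: to turn convergence in the weighted norm into pointwise convergence, and to see
  that a function of norm at most 1 cannot equal 1 close to the origin.
\<close>

lemma wnorm_ge:
  assumes "0 \<le> a" "a < b" "0 \<le> e" and f: "\<And>w. a < w \<Longrightarrow> w < b \<Longrightarrow> e \<le> \<bar>f w\<bar>"
  shows "ennreal (e * (b - a) / b\<^sup>2) \<le> wnorm f"
proof -
  have "ennreal (e * (b - a) / b\<^sup>2) = (\<integral>\<^sup>+w. ennreal (e / b\<^sup>2) * indicator {a<..<b} w \<partial>lborel)"
    using assms(1-3) by (simp add: nn_integral_cmult_indicator flip: ennreal_mult')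
  also have "\<dots> \<le> wnorm f"
    unfolding wnorm_def
  proof (rule nn_integral_mono)
    fix w
    show "ennreal (e / b\<^sup>2) * indicator {a<..<b} w \<le> ennreal (\<bar>f w\<bar> / w\<^sup>2) * indicator {0<..} w"
    proof (cases "a < w \<and> w < b")
      case True
      then have "e / b\<^sup>2 \<le> \<bar>f w\<bar> / w\<^sup>2"
        using assms(1,3) f[of w] by (intro frac_le power_mono) auto
      then show ?thesis using True assms(1) by (simp add: ennreal_leI)
    qed (auto simp: indicator_def)
  qed
  finally show ?thesis .
qed

lemma cadlag_D_mono:
  assumes "H \<in> cadlag_D" "x \<le> y" shows "H x \<le> H y"
  using assms mono_onD[of "{0..}" H x y]
  by (cases "0 \<le> x"; cases "0 \<le> y") (auto simp: cadlag_D_def L1loc_def)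

lemma cadlag_D_bounds:
  assumes "H \<in> cadlag_D" shows "0 \<le> H x" "H x \<le> 1"
  using assms by (cases "0 \<le> x"; auto simp: cadlag_D_def L1loc_def)+

lemma cadlag_D_right_cont:
  assumes "H \<in> cadlag_D" shows "continuous (at_right x) H"
proof (cases "0 \<le> x")
  case False
  then have "\<forall>\<^sub>F z in nhds x. H z = 0"
    using eventually_nhds_in_open[of "{..<0}" x] assms
    by (auto simp: cadlag_D_def L1loc_def elim: eventually_mono)
  then have "isCont H x" by (subst isCont_cong) auto
  then show ?thesis by (rule continuous_at_imp_continuous_at_within)
qed (use assms in \<open>auto simp: cadlag_D_def\<close>)

lemma survival_cadlag_D:
  assumes "H \<in> cadlag_D" "0 \<le> k" shows "survival (\<lambda>x. (1 - H x) powr k)"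
  using cadlag_D_mono[OF assms(1)] cadlag_D_bounds[OF assms(1)] assms(2)
  by unfold_locales (auto intro!: powr_mono2 powr_le1)

lemma survival_right_cont:
  assumes "H \<in> cadlag_D" "0 < k" shows "continuous (at_right x) (\<lambda>x. (1 - H x) powr k)"
  unfolding continuous_within
  using cadlag_D_right_cont[OF assms(1), of x] cadlag_D_bounds[OF assms(1)] assms(2)
  by (intro tendsto_powr' tendsto_intros) (auto simp: continuous_within)

section \<open>Passing to the limit along solutions of the evolution equation\<close>

locale evolution_solution =
  fixes k :: real and \<Psi> :: "real \<Rightarrow> real" and X :: "real \<Rightarrow> real \<Rightarrow> real"
  assumes k: "1 < k"
    and \<Psi>: "\<And>u. u \<in> {0..1} \<Longrightarrow> \<Psi> u = 1 - (1 - u) powr k"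
    and solution: "X \<in> evolution_solutions \<Psi>"
begin

definition V :: "real \<Rightarrow> real \<Rightarrow> real" where "V s z = (1 - X s z) powr k"

lemma X_cadlag: assumes "0 \<le> t" shows "X t \<in> cadlag_D"
proof -
  have "X \<in> borel_paths cadlag_D1" using solution by (simp add: evolution_solutions_def)
  then have "X t \<in> space (sigma cadlag_D1 {U. openin (subtopology L1loc_topology cadlag_D1) U})"
    unfolding borel_paths_def using assms by (elim measurable_space) (simp add: space_restrict_space)
  then show ?thesis by (auto simp: space_measure_of_conv cadlag_D1_def split: if_splits)
qed

lemmas X_mono = cadlag_D_mono[OF X_cadlag]
lemmas X_bounds = cadlag_D_bounds[OF X_cadlag]

lemma survival_V: "0 \<le> t \<Longrightarrow> survival (V t)"
  unfolding V_def using survival_cadlag_D[OF X_cadlag] k by simp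

text \<open>
  The evolution equation at the moving point \<open>exp t * y\<close>, whose backward characteristic
  \<open>exp (s - t) * (exp t * y) = exp s * y\<close> does not depend on \<open>t\<close>. Hence the integrand is the same for
  all \<open>t\<close>, and the values at two times can be subtracted.
\<close>

lemma evolution_eq_flux:
  assumes t: "0 \<le> t" and y: "0 < y"
  shows "X t (exp t * y) = X 0 y + (LINT s:{0..t}|lborel. exp s * y * flux (V s) (exp s * y))"
proof -
  have "X t (exp t * y) = evolution \<Psi> X t (exp t * y)"
    using solution t y by (simp add: evolution_solutions_def)
  also have "\<dots> = X 0 (exp (- t) * (exp t * y)) + (LINT s:{0..t}|lborel. exp s * y * flux (V s) (exp s * y))"
    unfolding evolution_def
  proof (intro arg_cong2[where f = "(+)"] refl set_lebesgue_integral_cong ballI allI impI)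
    fix s assume "s \<in> {0..t}"
    then have s: "0 \<le> s" by simp
    have e: "exp (s - t) * (exp t * y) = exp s * y" by (simp add: exp_diff)
    have \<Psi>X: "(\<lambda>z. \<Psi> (X s z)) = (\<lambda>z. 1 - V s z)"
      using \<Psi> X_bounds[OF s] by (auto simp: V_def)
    have "continuous (at_right x) (V s)" for x
      unfolding V_def using survival_right_cont[OF X_cadlag[OF s]] k by simp
    then show "(exp (s - t) * (exp t * y))\<^sup>2 *
       (LINT z:{exp (s - t) * (exp t * y)<..}|interval_measure (\<lambda>z. \<Psi> (X s z)). 1 / z) =
       exp s * y * flux (V s) (exp s * y)"
      unfolding e \<Psi>X using survival.stieltjes_tail_eq_flux[OF survival_V[OF s], of "exp s * y"] y
      by (simp add: power2_eq_square mult.assoc)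
  qed simp
  also have "exp (- t) * (exp t * y) = y" by (simp add: exp_minus)
  finally show ?thesis .
qed

lemma flux_V_bounds: "0 \<le> s \<Longrightarrow> 0 < y \<Longrightarrow> 0 \<le> flux (V s) y \<and> flux (V s) y \<le> V s y \<and> flux (V s) y \<le> 1"
  using survival.flux_bounds[OF survival_V] survival.bounds[OF survival_V] by (meson order_trans)

lemma X_along_characteristic:
  assumes "0 \<le> t" "0 < y" shows "X 0 y \<le> X t (exp t * y)"
proof -
  have "0 \<le> indicator {0..t} s *\<^sub>R (exp s * y * flux (V s) (exp s * y))" for s
    using flux_V_bounds[of s "exp s * y"] assms by (auto simp: indicator_def)
  then show ?thesis
    using evolution_eq_flux[OF assms] unfolding set_lebesgue_integral_def by (simp add: integral_nonneg)
qed

text \<open>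
  The Lebesgue integral of a function that is not integrable is 0 by convention, so integrability
  must be established before integrals are split. It can be read off from the equation itself.
  If the integrand failed to be integrable on \<open>{0..t}\<close>, it would fail on every larger interval
  as well, and \<open>X u (exp u * y)\<close> would keep the value \<open>X 0 y\<close> for all \<open>u \<ge> t\<close>; tightness forces this
  quantity above any number less than 1. This leaves \<open>X 0 y = 1\<close>; but then all the mass lies
  below the characteristic at all times, and the integrand vanishes.
\<close>

lemma source_integrable:
  assumes t: "0 \<le> t" and y: "0 < y"
  shows "set_integrable lborel {0..t} (\<lambda>s. exp s * y * flux (V s) (exp s * y))" (is "set_integrable _ _ ?g")
proof (cases "X 0 y = 1")
  case True
  have "?g s = 0" if "s \<in> {0..t}" for s
  proof -
    have "X s (exp s * y) = 1"
      using X_along_characteristic[of s y] X_bounds(2)[of s "exp s * y"] that y True by auto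
    then have "V s (exp s * y) = 0" using k by (simp add: V_def)
    then show ?thesis using flux_V_bounds[of s "exp s * y"] that y by simp
  qed
  then have "set_integrable lborel {0..t} ?g = set_integrable lborel {0..t} (\<lambda>_. 0 :: real)"
    by (intro set_integrable_cong refl) auto
  then show ?thesis by (simp add: set_integrable_def)
next
  case False
  then have "X 0 y < 1" using X_bounds(2)[of 0 y] by simp
  moreover have "tight_family {0..} X" using solution by (simp add: evolution_solutions_def)
  ultimately obtain N where N: "\<And>u. 0 \<le> u \<Longrightarrow> X 0 y < X u N"
    unfolding tight_family_def by (metis diff_gt_0_iff_gt diff_diff_eq2 add_diff_cancel_left' atLeast_iff)
  \<comment> \<open>by time \<open>u\<close> the characteristic through \<open>y\<close> has passed \<open>N\<close>\<close>
  define u where "u = max t (N / y)"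
  have u: "0 \<le> u" "t \<le> u" "N \<le> exp u * y"
  proof -
    show "0 \<le> u" "t \<le> u" using t by (auto simp: u_def)
    have "N / y \<le> u" by (simp add: u_def)
    also have "u \<le> exp u" using exp_ge_add_one_self[of u] by linarith
    finally show "N \<le> exp u * y" using y by (simp add: field_simps)
  qed
  have "set_integrable lborel {0..u} ?g"
  proof (rule ccontr)
    assume "\<not> ?thesis"
    then have "X u (exp u * y) = X 0 y"
      using evolution_eq_flux[OF u(1) y]
      by (simp add: set_integrable_def set_lebesgue_integral_def not_integrable_integral_eq)
    then show False using N[OF u(1)] X_mono[OF u(1) u(3)] by simp
  qed
  then show ?thesis by (rule set_integrable_subset) (use u in auto)
qed

lemma increment:
  assumes t: "0 \<le> t" and h: "0 \<le> h" and x: "0 < x"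
  shows "(\<lambda>s. exp s * x * flux (V (t + s)) (exp s * x)) integrable_on {0..h}" (is ?int)
    and "X (t + h) (exp h * x) - X t x = integral {0..h} (\<lambda>s. exp s * x * flux (V (t + s)) (exp s * x))" (is ?eq)
proof -
  define y where "y = exp (- t) * x"
  define g where "g s = exp s * y * flux (V s) (exp s * y)" for s
  have y: "0 < y" using x by (simp add: y_def)
  have int: "g integrable_on {0..u}" and eq: "X u (exp u * y) = X 0 y + integral {0..u} g" if "0 \<le> u" for u
    using set_borel_integral_eq_integral[OF source_integrable[OF that y]] evolution_eq_flux[OF that y]
    by (auto simp: g_def[abs_def])
  \<comment> \<open>the integrand of the increment is that of \<open>evolution_eq_flux\<close> shifted by \<open>t\<close>\<close>
  have g_shift: "g (t + s) = exp s * x * flux (V (t + s)) (exp s * x)" for s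
    by (simp add: g_def y_def exp_add exp_minus mult_ac)
  have "g integrable_on {t..t + h}" by (rule integrable_subinterval_real[OF int[of "t + h"]]) (use t h in auto)
  then have "(g has_integral integral {t..t + h} g) (cbox t (t + h))" by (simp add: has_integral_integral)
  from has_integral_affinity[OF this, of 1 t]
  have "((\<lambda>s. g (t + s)) has_integral integral {t..t + h} g) {0..h}"
    by (simp add: add.commute image_diff_atLeastAtMost)
  then have *: "((\<lambda>s. exp s * x * flux (V (t + s)) (exp s * x)) has_integral integral {t..t + h} g) {0..h}"
    by (simp add: g_shift)
  then show ?int by blast
  have "integral {0..t} g + integral {t..t + h} g = integral {0..t + h} g"
    using t h int[of "t + h"] by (intro Henstock_Kurzweil_Integration.integral_combine) auto
  moreover have "exp t * y = x"
    by (simp add: y_def exp_minus_inverse flip: mult.assoc)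
  moreover from this have "exp (t + h) * y = exp h * x"
    by (simp add: exp_add mult.assoc mult.left_commute[of "exp t"])
  ultimately show ?eq using eq[of t] eq[of "t + h"] integral_unique[OF *] t h by simp
qed

lemma increment_bound:
  assumes t: "0 \<le> t" and h: "0 \<le> h" and x: "0 < x"
  shows "X (t + h) (exp h * x) - X t x \<le> h * (exp h * x)"
proof -
  have "integral {0..h} (\<lambda>s. exp s * x * flux (V (t + s)) (exp s * x)) \<le> integral {0..h} (\<lambda>s. exp h * x)"
  proof (rule integral_le[OF increment(1)[OF assms]])
    fix s assume s: "s \<in> {0..h}"
    then have "exp s * x * flux (V (t + s)) (exp s * x) \<le> exp s * x * 1"
      using flux_V_bounds[of "t + s" "exp s * x"] t x by (intro mult_left_mono) auto
    also have "\<dots> \<le> exp h * x" using s x by simp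
    finally show "exp s * x * flux (V (t + s)) (exp s * x) \<le> exp h * x" .
  qed auto
  then show ?thesis using increment(2)[OF assms] h by (simp add: mult_ac)
qed

end

locale attracted_solution = evolution_solution +
  fixes F :: "real \<Rightarrow> real"
  assumes F_cadlag: "F \<in> cadlag_D"
    and attracted: "\<And>t. 0 \<le> t \<Longrightarrow> wnorm (\<lambda>x. X t x - F x) \<le> ennreal (2 * exp (- t))"
begin

definition U :: "real \<Rightarrow> real" where "U z = (1 - F z) powr k"

lemmas F_mono = cadlag_D_mono[OF F_cadlag]
lemmas F_bounds = cadlag_D_bounds[OF F_cadlag]

lemma survival_U: "survival U"
  unfolding U_def using survival_cadlag_D[OF F_cadlag] k by simp

lemma separation_bound:
  assumes "0 \<le> t" "0 \<le> a" "a < b" "0 \<le> e" and "\<And>w. a < w \<Longrightarrow> w < b \<Longrightarrow> e \<le> \<bar>X t w - F w\<bar>"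
  shows "e * (b - a) / b\<^sup>2 \<le> 2 * exp (- t)"
proof -
  have "ennreal (e * (b - a) / b\<^sup>2) \<le> ennreal (2 * exp (- t))"
    using wnorm_ge[OF assms(2-5)] attracted[OF assms(1)] by (rule order_trans)
  then show ?thesis by simp
qed

text \<open>
  If \<open>X t y\<close> exceeds \<open>F y\<close> by \<open>e\<close>, then by monotonicity of \<open>X t\<close> and continuity of \<open>F\<close> at \<open>y\<close> the
  difference \<open>X t - F\<close> is at least \<open>e / 2\<close> on a whole interval to the right of \<open>y\<close>, whose length does
  not depend on \<open>t\<close>; this bounds the weighted norm from below. If \<open>X t y\<close> is too small, an interval to
  the left of \<open>y\<close> does the same.
\<close>

lemma tendsto_at_continuity_point:
  assumes y: "0 < y" and cont: "isCont F y"
  shows "((\<lambda>t. X t y) \<longlongrightarrow> F y) at_top"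
proof (rule tendstoI)
  fix e :: real assume e: "0 < e"
  obtain d0 where "0 < d0" "\<And>w. \<bar>w - y\<bar> < d0 \<Longrightarrow> \<bar>F w - F y\<bar> < e / 2"
    using cont e unfolding continuous_at_eps_delta by (metis dist_real_def half_gt_zero)
  moreover define d where "d = min d0 y"
  ultimately have d: "0 < d" "d \<le> y" and close: "\<And>w. \<bar>w - y\<bar> < d \<Longrightarrow> \<bar>F w - F y\<bar> < e / 2"
    using y by auto
  \<comment> \<open>a common lower bound for the two norms that arise below, as both intervals lie in \<open>{0..2 * y}\<close>\<close>
  define m where "m = e / 2 * d / (2 * y)\<^sup>2"
  have m: "0 < m" using e d y by (simp add: m_def)
  have "((\<lambda>t::real. 2 * exp (- t)) \<longlongrightarrow> 2 * 0) at_top"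
    by (rule tendsto_mult_left[OF filterlim_compose[OF exp_at_bot filterlim_uminus_at_bot_at_top]])
  then have "\<forall>\<^sub>F t in at_top. 2 * exp (- t) < m" using m by (intro order_tendstoD) auto
  then show "\<forall>\<^sub>F t in at_top. dist (X t y) (F y) < e"
    using eventually_ge_at_top[of 0]
  proof eventually_elim
    case (elim t)
    have "X t y - F y < e"
    proof (rule ccontr)
      assume "\<not> ?thesis"
      then have "e / 2 * (y + d - y) / (y + d)\<^sup>2 \<le> 2 * exp (- t)"
      proof (intro separation_bound)
        fix w assume w: "y < w" "w < y + d"
        then have "\<bar>F w - F y\<bar> < e / 2" "X t y \<le> X t w" using close[of w] X_mono[of t y w] elim by auto
        then show "e / 2 \<le> \<bar>X t w - F w\<bar>" if "\<not> X t y - F y < e" using that by linarith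
      qed (use elim y d e in auto)
      moreover have "m \<le> e / 2 * (y + d - y) / (y + d)\<^sup>2"
        unfolding m_def using y d e by (intro frac_le power_mono) auto
      ultimately show False using elim by simp
    qed
    moreover have "F y - X t y < e"
    proof (rule ccontr)
      assume "\<not> ?thesis"
      then have "e / 2 * (y - (y - d)) / y\<^sup>2 \<le> 2 * exp (- t)"
      proof (intro separation_bound)
        fix w assume w: "y - d < w" "w < y"
        then have "\<bar>F w - F y\<bar> < e / 2" "X t w \<le> X t y" using close[of w] X_mono[of t w y] elim by auto
        then show "e / 2 \<le> \<bar>X t w - F w\<bar>" if "\<not> F y - X t y < e" using that by linarith
      qed (use elim y d e in auto)
      moreover have "m \<le> e / 2 * (y - (y - d)) / y\<^sup>2"
        unfolding m_def using y d e by (intro frac_le power_mono) auto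
      ultimately show False using elim by simp
    qed
    ultimately show ?case by (simp add: dist_real_def abs_less_iff)
  qed
qed

lemma continuity_point_between:
  assumes "a < b" shows "\<exists>c. a < c \<and> c < b \<and> isCont F c"
proof (rule ccontr)
  assume "\<not> ?thesis"
  then have "{a<..<b} \<subseteq> {c. \<not> isCont F c}" by auto
  moreover have "countable {c. \<not> isCont F c}"
    by (rule mono_ctble_discont) (auto simp: mono_def F_mono)
  ultimately have "countable {a<..<b}" by (rule countable_subset)
  then show False using uncountable_open_interval[of a b] assms by simp
qed

lemma F_increment_bound:
  assumes ab: "0 < a" "a < b" and cont: "isCont F a" "isCont F b"
  shows "F b - F a \<le> b * ln (b / a)"
proof (rule tendsto_upperbound)
  have h: "0 \<le> ln (b / a)" "exp (ln (b / a)) = b / a" using ab by auto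
  have "((\<lambda>t. X (ln (b / a) + t) b) \<longlongrightarrow> F b) at_top"
    by (rule filterlim_compose[OF tendsto_at_continuity_point filterlim_tendsto_add_at_top[OF tendsto_const filterlim_ident]])
       (use ab cont in auto)
  then show "((\<lambda>t. X (ln (b / a) + t) b - X t a) \<longlongrightarrow> F b - F a) at_top"
    using ab cont by (intro tendsto_diff tendsto_at_continuity_point) auto
  show "\<forall>\<^sub>F t in at_top. X (ln (b / a) + t) b - X t a \<le> b * ln (b / a)"
    using eventually_ge_at_top[of 0]
  proof eventually_elim
    case (elim t)
    show ?case using increment_bound[OF elim h(1) ab(1)] h ab by (simp add: add.commute mult.commute)
  qed
qed simp

text \<open>
  Continuity at \<open>y\<close> is obtained from continuity points on either side of \<open>y\<close>, which exist because a
  monotone function has only countably many discontinuities, and between which the growth of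
  \<open>F\<close> is controlled by the increment bound.
\<close>

lemma isCont_F: assumes y: "0 < y" shows "isCont F y"
  unfolding continuous_at_eps_delta
proof (intro allI impI)
  fix e :: real assume e: "0 < e"
  \<comment> \<open>with \<open>b / a \<le> (1 + m)\<^sup>2\<close> and \<open>b \<le> 2 * y\<close> the increment bound gives \<open>F b - F a \<le> 4 * y * m \<le> e / 2\<close>\<close>
  define m where "m = min 1 (e / (8 * y))"
  have m: "0 < m" "m \<le> 1" "m \<le> e / (8 * y)" using e y by (auto simp: m_def)
  obtain a where a: "y / (1 + m) < a" "a < y" "isCont F a"
    using continuity_point_between[of "y / (1 + m)" y] m y by (auto simp: field_simps)
  obtain b where b: "y < b" "b < y * (1 + m)" "isCont F b"
    using continuity_point_between[of y "y * (1 + m)"] m y by auto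
  have a0: "0 < a" using a m y by (smt (verit) divide_pos_pos)
  have ba: "b / a \<le> (1 + m) * (1 + m)"
  proof -
    have "b \<le> y * (1 + m)" using b by simp
    also have "\<dots> \<le> (a * (1 + m)) * (1 + m)" using a m by (intro mult_right_mono) (auto simp: field_simps)
    finally show ?thesis using a0 by (simp add: pos_divide_le_eq mult_ac)
  qed
  have "F b - F a \<le> b * ln (b / a)" by (rule F_increment_bound) (use a a0 b in auto)
  also have "\<dots> \<le> (2 * y) * (2 * m)"
  proof (rule mult_mono)
    have "y * (1 + m) \<le> y * 2" using m y by (intro mult_left_mono) auto
    then show "b \<le> 2 * y" using b by simp
    have "ln (b / a) \<le> ln ((1 + m) * (1 + m))" using ba a a0 b m by (subst ln_le_cancel_iff) auto
    also have "\<dots> = 2 * ln (1 + m)" using m by (simp add: ln_mult)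
    also have "\<dots> \<le> 2 * m" using ln_add_one_self_le_self[of m] m by simp
    finally show "ln (b / a) \<le> 2 * m" .
    show "0 \<le> ln (b / a)" using a a0 b by simp
  qed (use y in auto)
  also have "\<dots> = 4 * y * m" by simp
  also have "\<dots> \<le> 4 * y * (e / (8 * y))" using m y by (intro mult_left_mono) auto
  also have "\<dots> < e" using e y by simp
  finally have "F b - F a < e" .
  then show "\<exists>d>0. \<forall>x. dist x y < d \<longrightarrow> dist (F x) (F y) < e"
  proof (intro exI[of _ "min (y - a) (b - y)"] conjI allI impI)
    fix x assume "dist x y < min (y - a) (b - y)"
    then have "a \<le> x" "x \<le> b" by (auto simp: dist_real_def)
    then have "F a \<le> F x" "F x \<le> F b" "F a \<le> F y" "F y \<le> F b" using F_mono a b by auto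
    then show "dist (F x) (F y) < e" if "F b - F a < e" using that by (auto simp: dist_real_def)
  qed (use a b in auto)
qed

lemma X_tendsto_F: "0 < y \<Longrightarrow> ((\<lambda>t. X t y) \<longlongrightarrow> F y) at_top"
  by (rule tendsto_at_continuity_point[OF _ isCont_F])

lemma flux_V_tendsto:
  assumes s: "0 \<le> s" and y: "0 < y"
  shows "(\<lambda>n. flux (V (real n + s)) y) \<longlonglongrightarrow> flux U y"
proof (rule flux_tendsto[OF _ survival_U y])
  show "survival (V (real n + s))" for n using survival_V s by simp
  fix w assume "y \<le> w"
  then have "0 < w" using y by simp
  have "(\<lambda>n. X (s + real n) w) \<longlonglongrightarrow> F w"
    by (rule filterlim_compose[OF X_tendsto_F[OF \<open>0 < w\<close>]
          filterlim_tendsto_add_at_top[OF tendsto_const filterlim_real_sequentially]])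
  then show "(\<lambda>n. V (real n + s) w) \<longlonglongrightarrow> U w"
    unfolding V_def U_def using k X_bounds s
    by (intro tendsto_powr' tendsto_intros) (auto simp: add.commute)
qed

lemma F_increment:
  assumes h: "0 \<le> h" and x: "0 < x"
  shows "F (exp h * x) - F x = integral {0..h} (\<lambda>s. exp s * x * flux U (exp s * x))"
proof (rule LIMSEQ_unique)
  let ?g = "\<lambda>n s. exp s * x * flux (V (real n + s)) (exp s * x)"
  have "(\<lambda>n. integral {0..h} (?g n)) \<longlonglongrightarrow> integral {0..h} (\<lambda>s. exp s * x * flux U (exp s * x))"
  proof (rule dominated_convergence(2))
    show "?g n integrable_on {0..h}" for n using increment(1)[of "real n" h x] h x by simp
    show "(\<lambda>s. exp s * x) integrable_on {0..h}"
      by (intro integrable_continuous_real continuous_intros)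
    show "norm (?g n s) \<le> exp s * x" if "s \<in> {0..h}" for n s
      using flux_V_bounds[of "real n + s" "exp s * x"] that x
      by (simp add: abs_mult mult_left_le)
    show "(\<lambda>n. ?g n s) \<longlonglongrightarrow> exp s * x * flux U (exp s * x)" if "s \<in> {0..h}" for s
      using flux_V_tendsto[of s "exp s * x"] that x by (intro tendsto_intros) auto
  qed
  moreover have "integral {0..h} (?g n) = X (h + real n) (exp h * x) - X (real n) x" for n
    using increment(2)[of "real n" h x] h x by (simp add: add.commute)
  ultimately show "(\<lambda>n. X (h + real n) (exp h * x) - X (real n) x)
      \<longlonglongrightarrow> integral {0..h} (\<lambda>s. exp s * x * flux U (exp s * x))" by simp
  show "(\<lambda>n. X (h + real n) (exp h * x) - X (real n) x) \<longlonglongrightarrow> F (exp h * x) - F x"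
    using x by (intro tendsto_diff filterlim_compose[OF X_tendsto_F] filterlim_real_sequentially
        filterlim_tendsto_add_at_top[OF tendsto_const]) auto
qed

lemma isCont_U: "0 < y \<Longrightarrow> isCont U y"
  unfolding U_def isCont_def using isCont_F[of y] F_bounds k
  by (intro tendsto_powr' tendsto_intros) (auto simp: isCont_def)

definition J :: "real \<Rightarrow> real" where "J y = (LINT w:{y<..}|lborel. U w / w\<^sup>2)"

lemma DERIV_J: assumes y: "0 < y" shows "(J has_real_derivative - (U y / y\<^sup>2)) (at y)"
proof -
  let ?g = "\<lambda>w. U w / w\<^sup>2"
  \<comment> \<open>a base point to the left of \<open>y\<close>, so that \<open>J\<close> differs from a constant by an integral over a compact interval\<close>
  define a where "a = y / 2"
  have a: "0 < a" "a < y" using y by (auto simp: a_def)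
  have J: "(?g has_integral J x) {x<..}" if "0 < x" for x
    unfolding J_def
    using set_borel_integral_eq_integral[OF survival.tail_integrable[OF survival_U that]]
    by (simp add: has_integral_integrable_integral)
  have cont: "continuous_on {a..2 * y} ?g"
    using a by (intro continuous_at_imp_continuous_on ballI continuous_intros isCont_U) auto
  have *: "J a - integral {a..x} ?g = J x" if "x \<in> {a<..<2 * y}" for x
  proof -
    have "?g integrable_on {a..x}"
      by (intro integrable_continuous_real continuous_on_subset[OF cont]) (use that in auto)
    then have "(?g has_integral integral {a..x} ?g) {a..x}" by (rule integrable_integral)
    then have "(?g has_integral integral {a..x} ?g) {a<..x}"
      by (rule has_integral_spike_set_eq[THEN iffD1, rotated -1])
         (auto intro: negligible_subset[of "{a}"])
    moreover have "{a<..x} \<inter> {x<..} = {}" by auto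
    ultimately have "(?g has_integral integral {a..x} ?g + J x) ({a<..x} \<union> {x<..})"
      using that a by (intro has_integral_Un J) auto
    also have "{a<..x} \<union> {x<..} = {a<..}" using that by auto
    finally show ?thesis using has_integral_unique[OF J[OF a(1)]] by fastforce
  qed
  have "((\<lambda>x. integral {a..x} ?g) has_real_derivative ?g y) (at y within {a..2 * y})"
    by (rule integral_has_real_derivative[OF cont]) (use a in auto)
  then have "((\<lambda>x. integral {a..x} ?g) has_real_derivative ?g y) (at y)"
    using a by (subst (asm) at_within_Icc_at) auto
  then have "((\<lambda>x. J a - integral {a..x} ?g) has_real_derivative 0 - ?g y) (at y)"
    by (intro derivative_intros)
  then have "(J has_real_derivative 0 - ?g y) (at y)"
    by (rule has_field_derivative_transform_within_open[where S = "{a<..<2 * y}"]) (use * a in auto)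
  then show ?thesis by simp
qed

lemma flux_U: "flux U y = U y - y * J y"
  by (simp add: flux_def J_def)

lemma continuous_on_flux_U: "continuous_on {0<..} (flux U)"
proof -
  have "continuous_on {0<..} U" "continuous_on {0<..} J"
    by (auto intro!: continuous_at_imp_continuous_on isCont_U DERIV_isCont[OF DERIV_J])
  then have "continuous_on {0<..} (\<lambda>y. U y - y * J y)" by (intro continuous_intros)
  then show ?thesis by (simp flip: flux_U)
qed

lemma DERIV_F: assumes y: "0 < y" shows "(F has_real_derivative flux U y) (at y)"
proof -
  \<comment> \<open>starting the characteristic at \<open>y / 2\<close> makes \<open>y\<close> correspond to the interior time \<open>ln 2\<close>\<close>
  define x where "x = y / 2"
  have x: "0 < x" using y by (simp add: x_def)
  let ?g = "\<lambda>s. exp s * x * flux U (exp s * x)"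
  let ?Q = "\<lambda>h. integral {0..h} ?g"
  have "continuous_on {0..2} (\<lambda>s. flux U (exp s * x))"
    by (rule continuous_on_compose2[OF continuous_on_flux_U]) (use x in \<open>auto intro!: continuous_intros\<close>)
  then have "continuous_on {0..2} ?g"
    by (intro continuous_on_mult continuous_on_exp continuous_on_id continuous_on_const)
  moreover have ln2: "0 < ln (2::real)" "ln 2 < (2::real)" using ln_2_less_1 by auto
  ultimately have "(?Q has_real_derivative ?g (ln 2)) (at (ln 2) within {0..2})"
    by (intro integral_has_real_derivative) (auto intro: less_imp_le)
  then have "(?Q has_real_derivative ?g (ln 2)) (at (ln 2))"
    using ln2 by (subst (asm) at_within_Icc_at) auto
  moreover have "ln (y / x) = ln 2" using y by (simp add: x_def)
  ultimately have "(?Q has_real_derivative ?g (ln 2)) (at (ln (y / x)))" by simp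
  moreover have "((\<lambda>z. ln (z / x)) has_real_derivative 1 / y) (at y)"
    using x y by (auto intro!: derivative_eq_intros)
  ultimately have "((\<lambda>z. ?Q (ln (z / x))) has_real_derivative ?g (ln 2) * (1 / y)) (at y)"
    by (rule DERIV_chain2)
  then have "((\<lambda>z. F x + ?Q (ln (z / x))) has_real_derivative 0 + ?g (ln 2) * (1 / y)) (at y)"
    by (intro derivative_intros)
  then have "(F has_real_derivative 0 + ?g (ln 2) * (1 / y)) (at y)"
  proof (rule has_field_derivative_transform_within_open[where S = "{x<..}"])
    fix z assume "z \<in> {x<..}"
    then show "F x + ?Q (ln (z / x)) = F z"
      using F_increment[of "ln (z / x)" x] x by simp
  qed (use x y x_def in auto)
  also have "0 + ?g (ln 2) * (1 / y) = flux U y" using y by (simp add: x_def)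
  finally show ?thesis .
qed

end

section \<open>Limits by a square-root iteration, and the tail of the profile equation\<close>

text \<open>
  The infimum \<open>S\<close> of all eventual upper bounds of \<open>p\<close> is positive, and every eventual upper bound \<open>P\<close>
  produces the upper bound \<open>sqrt (L * P + e)\<close>. Hence \<open>S\<^sup>2 \<le> L * P\<close> for all such \<open>P\<close>, so
  \<open>S\<^sup>2 \<le> L * S\<close> and \<open>S \<le> L\<close>. Symmetrically, the supremum of all eventual lower bounds is at least \<open>L\<close>.
\<close>

lemma tendsto_of_sqrt_contraction:
  fixes p :: "real \<Rightarrow> real"
  assumes L: "0 < L" and ab: "0 < a" "\<forall>\<^sub>F x in at_top. a \<le> p x" "\<forall>\<^sub>F x in at_top. p x \<le> b"
    and up: "\<And>P e. 0 < P \<Longrightarrow> 0 < e \<Longrightarrow> \<forall>\<^sub>F x in at_top. p x \<le> P \<Longrightarrow> \<forall>\<^sub>F x in at_top. (p x)\<^sup>2 \<le> L * P + e"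
    and lo: "\<And>P e. 0 < P \<Longrightarrow> 0 < e \<Longrightarrow> \<forall>\<^sub>F x in at_top. P \<le> p x \<Longrightarrow> \<forall>\<^sub>F x in at_top. L * P - e \<le> (p x)\<^sup>2"
  shows "(p \<longlongrightarrow> L) at_top"
proof -
  have a_le: "a \<le> P" if "\<forall>\<^sub>F x in at_top. p x \<le> P" for P
  proof -
    have "\<forall>\<^sub>F x in at_top. a \<le> p x \<and> p x \<le> P" using ab(2) that by (rule eventually_conj)
    then show ?thesis by (fastforce dest: eventually_happens)
  qed
  have b_ge: "P \<le> b" if "\<forall>\<^sub>F x in at_top. P \<le> p x" for P
  proof -
    have "\<forall>\<^sub>F x in at_top. P \<le> p x \<and> p x \<le> b" using that ab(3) by (rule eventually_conj)
    then show ?thesis by (fastforce dest: eventually_happens)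
  qed
  define U where "U = {P. \<forall>\<^sub>F x in at_top. p x \<le> P}"
  define D where "D = {P. \<forall>\<^sub>F x in at_top. P \<le> p x}"
  have U: "U \<noteq> {}" "bdd_below U" using ab(3) a_le by (auto simp: U_def bdd_below_def)
  have D: "D \<noteq> {}" "bdd_above D" using ab(2) b_ge by (auto simp: D_def bdd_above_def)
  have "a \<le> Inf U" using U a_le by (intro cInf_greatest) (auto simp: U_def)
  have "a \<le> Sup D" using D ab(2) by (intro cSup_upper) (auto simp: D_def)
  \<comment> \<open>\<open>Inf U\<close> and \<open>Sup D\<close> are the upper and the lower limit of \<open>p\<close>\<close>
  have U_le: "Inf U \<le> L"
  proof -
    have "(Inf U)\<^sup>2 \<le> L * P" if P: "P \<in> U" for P
    proof -
      have "0 < P" using a_le P ab(1) unfolding U_def by force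
      have "(Inf U)\<^sup>2 \<le> L * P + e" if e: "0 < e" for e
      proof -
        have "\<forall>\<^sub>F x in at_top. (p x)\<^sup>2 \<le> L * P + e" using up[OF \<open>0 < P\<close> e] P by (simp add: U_def)
        then have "\<forall>\<^sub>F x in at_top. p x \<le> sqrt (L * P + e)" by eventually_elim (rule real_le_rsqrt)
        then have "Inf U \<le> sqrt (L * P + e)" using U by (intro cInf_lower) (auto simp: U_def)
        then have "(Inf U)\<^sup>2 \<le> (sqrt (L * P + e))\<^sup>2" using \<open>a \<le> Inf U\<close> ab(1) by (intro power_mono) auto
        then show ?thesis using L \<open>0 < P\<close> e by simp
      qed
      then show ?thesis by (rule field_le_epsilon)
    qed
    then have "(Inf U)\<^sup>2 / L \<le> P" if "P \<in> U" for P
      unfolding pos_divide_le_eq[OF L] using that by (subst mult.commute)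
    then have "(Inf U)\<^sup>2 / L \<le> Inf U" using U by (intro cInf_greatest) auto
    then show ?thesis using L \<open>a \<le> Inf U\<close> ab(1) by (simp add: field_simps power2_eq_square)
  qed
  have D_ge: "L \<le> Sup D"
  proof -
    have "L * P \<le> (Sup D)\<^sup>2" if P: "P \<in> D" "0 < P" for P
    proof -
      have "L * P \<le> (Sup D)\<^sup>2 + e" if e: "0 < e" for e
      proof -
        have "\<forall>\<^sub>F x in at_top. L * P - e \<le> (p x)\<^sup>2" using lo[OF \<open>0 < P\<close> e] P by (simp add: D_def)
        with ab(2) have "\<forall>\<^sub>F x in at_top. sqrt (L * P - e) \<le> p x"
          by eventually_elim (rule real_le_lsqrt, use ab(1) in auto)
        then have "sqrt (L * P - e) \<le> Sup D" using D by (intro cSup_upper) (auto simp: D_def)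
        then have "L * P - e \<le> (Sup D)\<^sup>2" using \<open>a \<le> Sup D\<close> ab(1) by (meson sqrt_le_D)
        then show ?thesis by simp
      qed
      then show ?thesis by (rule field_le_epsilon)
    qed
    then have "P \<le> (Sup D)\<^sup>2 / L" if "P \<in> D" "0 < P" for P
      unfolding pos_le_divide_eq[OF L] using that by (subst mult.commute)
    moreover have "P \<le> (Sup D)\<^sup>2 / L" if "P \<le> 0" for P
      using that L by (meson order_trans zero_le_divide_iff zero_le_power2 less_imp_le)
    ultimately have "P \<le> (Sup D)\<^sup>2 / L" if "P \<in> D" for P
      using that by (meson not_le)
    then have "Sup D \<le> (Sup D)\<^sup>2 / L" using D by (intro cSup_least) auto
    then show ?thesis using L \<open>a \<le> Sup D\<close> ab(1) by (simp add: field_simps power2_eq_square)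
  qed
  show ?thesis
  proof (rule order_tendstoI)
    fix y assume "y < L"
    then obtain P where "P \<in> D" "y < P" using D_ge less_cSup_iff[OF D, of y] by (meson order_less_le_trans)
    then show "\<forall>\<^sub>F x in at_top. y < p x" by (auto simp: D_def elim: eventually_mono)
  next
    fix y assume "L < y"
    then obtain P where "P \<in> U" "P < y" using U_le cInf_less_iff[OF U, of y] by (meson order_le_less_trans)
    then show "\<forall>\<^sub>F x in at_top. p x < y" by (auto simp: U_def elim: eventually_mono)
  qed
qed

lemma DERIV_nonpos_decreasing:
  fixes h :: "real \<Rightarrow> real"
  assumes "a \<le> x" and "\<And>y. a \<le> y \<Longrightarrow> (h has_real_derivative d y) (at y)" and "\<And>y. a \<le> y \<Longrightarrow> d y \<le> 0"
  shows "h x \<le> h a"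
  by (rule DERIV_nonpos_imp_nonincreasing[OF assms(1)]) (use assms in blast)

lemma DERIV_nonneg_increasing:
  fixes h :: "real \<Rightarrow> real"
  assumes "a \<le> x" and "\<And>y. a \<le> y \<Longrightarrow> (h has_real_derivative d y) (at y)" and "\<And>y. a \<le> y \<Longrightarrow> 0 \<le> d y"
  shows "h a \<le> h x"
  by (rule DERIV_nonneg_imp_nondecreasing[OF assms(1)]) (use assms in blast)

lemma nonneg_of_antimono_tendsto_0:
  fixes h :: "real \<Rightarrow> real"
  assumes "\<And>y. x \<le> y \<Longrightarrow> (h has_real_derivative d y) (at y)" and "\<And>y. x \<le> y \<Longrightarrow> d y \<le> 0"
    and "(h \<longlongrightarrow> 0) at_top"
  shows "0 \<le> h x"
proof (rule tendsto_upperbound[OF assms(3)])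
  have "h y \<le> h x" if "x \<le> y" for y
    using that assms(1,2) by (rule DERIV_nonpos_decreasing)
  then show "\<forall>\<^sub>F y in at_top. h y \<le> h x" using eventually_ge_at_top by (rule eventually_mono[rotated])
qed auto

text \<open>
  The profile equation beyond some point \<open>a\<close>, with \<open>G\<close> in the role of \<open>1 - F\<close> and \<open>I\<close> in the role of
  the tail integral of \<open>G powr k / w\<^sup>2\<close>. Only the derivative of that integral and the sign of the flux
  enter the asymptotic analysis.
\<close>

locale profile_tail =
  fixes k a :: real and G I :: "real \<Rightarrow> real"
  assumes k: "1 < k" and a: "0 < a" "0 < G a"
    and G_bounds: "\<And>x. a \<le> x \<Longrightarrow> 0 \<le> G x \<and> G x \<le> 1"
    and I_bounds: "\<And>x. a \<le> x \<Longrightarrow> 0 \<le> I x \<and> x * I x \<le> G x powr k"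
    and DERIV_G: "\<And>x. a \<le> x \<Longrightarrow> (G has_real_derivative - (G x powr k - x * I x)) (at x)"
    and DERIV_I: "\<And>x. a \<le> x \<Longrightarrow> (I has_real_derivative - (G x powr k / x\<^sup>2)) (at x)"
    and G_lim: "(G \<longlongrightarrow> 0) at_top"
begin

text \<open>
  The density of the profile, \<open>f = - G'\<close>.
\<close>

definition f :: "real \<Rightarrow> real" where "f x = G x powr k - x * I x"

lemma f_bounds: "a \<le> x \<Longrightarrow> 0 \<le> f x \<and> f x \<le> G x powr k"
  using I_bounds[of x] a by (simp add: f_def)

text \<open>
  From \<open>- G' = f \<le> G powr k \<le> G\<close> the function \<open>G\<close> decays no faster than \<open>exp (- x)\<close>, so it never
  reaches 0.
\<close>

lemma G_pos: assumes "a \<le> x" shows "0 < G x"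
proof -
  have "G a * exp a \<le> G x * exp x"
  proof (rule DERIV_nonneg_increasing[OF assms])
    fix y assume y: "a \<le> y"
    show "((\<lambda>y. G y * exp y) has_real_derivative (- f y * exp y + exp y * G y)) (at y)"
      unfolding f_def by (rule DERIV_mult DERIV_G[OF y] DERIV_exp)+
    have "f y \<le> G y"
      using f_bounds[OF y] G_bounds[OF y] powr_mono'[of 1 k "G y"] k by auto
    then show "0 \<le> - f y * exp y + exp y * G y" by (simp add: mult.commute)
  qed
  then show ?thesis using a by (metis mult_pos_pos exp_gt_zero order_less_le_trans zero_less_mult_pos2)
qed

lemma DERIV_G': "a \<le> x \<Longrightarrow> (G has_real_derivative - f x) (at x)"
  using DERIV_G by (simp add: f_def)

lemma DERIV_G_powr:
  assumes "a \<le> x" shows "((\<lambda>x. G x powr e) has_real_derivative - (e * G x powr (e - 1) * f x)) (at x)"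
  by (rule derivative_eq_intros DERIV_G'[OF assms] refl G_pos[OF assms])+ (use G_pos[OF assms] in \<open>auto simp: powr_diff\<close>)

text \<open>
  The differentiated form of \<open>f x / x = (\<integral> z > x. 1 / z d\<Psi>(F z))\<close>: the two terms with
  \<open>G powr k / x\<^sup>2\<close> cancel.
\<close>

lemma DERIV_f_over_x:
  assumes "a \<le> x"
  shows "((\<lambda>x. f x / x) has_real_derivative - (k * G x powr (k - 1) * f x / x)) (at x)"
proof -
  have "x > 0" using a assms by linarith
  have "((\<lambda>x. G x powr k / x - I x) has_real_derivative
      (- (k * G x powr (k - 1) * f x) * x - G x powr k * 1) / (x * x) - - (G x powr k / x\<^sup>2)) (at x)"
    by (rule DERIV_diff DERIV_divide DERIV_G_powr DERIV_I[OF assms] DERIV_ident assms less_imp_neq[symmetric, OF \<open>x > 0\<close>])+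
  also have "(- (k * G x powr (k - 1) * f x) * x - G x powr k * 1) / (x * x) - - (G x powr k / x\<^sup>2) =
     - (k * G x powr (k - 1) * f x / x)"
    using \<open>x > 0\<close> by (simp add: field_simps power2_eq_square)
  finally have "((\<lambda>x. G x powr k / x - I x) has_real_derivative - (k * G x powr (k - 1) * f x / x)) (at x)" .
  then show ?thesis
  proof (rule DERIV_cong_ev[THEN iffD1, rotated -1])
    show "\<forall>\<^sub>F y in nhds x. G y powr k / y - I y = f y / y"
      by (rule eventually_mono[OF eventually_nhds_in_open[of "{0<..}" x]])
         (use \<open>x > 0\<close> in \<open>auto simp: f_def field_simps\<close>)
  qed auto
qed

lemma eventually_ge_a: "\<forall>\<^sub>F x in at_top. a \<le> x" by (rule eventually_ge_at_top)

lemma eventually_tailI: "(\<And>x. a \<le> x \<Longrightarrow> P x) \<Longrightarrow> eventually P at_top"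
  by (rule eventually_mono[OF eventually_ge_a])

lemma G_powr_lim: "0 < e \<Longrightarrow> ((\<lambda>x. G x powr e) \<longlongrightarrow> 0) at_top"
  by (rule tendsto_zero_powrI[OF G_lim tendsto_const])
     (auto intro: eventually_tailI simp: G_bounds)

text \<open>
  The difference of the two sides is \<open>G x / x - x * I x\<close>; it decreases to 0, its derivative being
  \<open>- G x / x\<^sup>2\<close>.
\<close>

lemma f_lower: assumes "a \<le> x" shows "G x powr k - G x / x \<le> f x"
proof -
  have "0 \<le> G x / x - x * I x"
  proof (rule nonneg_of_antimono_tendsto_0[where d = "\<lambda>y. - G y / y\<^sup>2" and h = "\<lambda>x. G x / x - x * I x"])
    fix y assume "x \<le> y"
    then have y: "a \<le> y" "0 < y" using assms a by auto
    have "((\<lambda>x. G x / x - x * I x) has_real_derivative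
       (- f y * y - G y * 1) / (y * y) - (1 * I y + - (G y powr k / y\<^sup>2) * y)) (at y)"
      by (rule DERIV_diff DERIV_divide DERIV_mult DERIV_G' DERIV_I DERIV_ident y less_imp_neq[OF y(2), symmetric])+
    also have "(- f y * y - G y * 1) / (y * y) - (1 * I y + - (G y powr k / y\<^sup>2) * y) = - G y / y\<^sup>2"
      using y unfolding f_def by (simp add: field_simps power2_eq_square)
    finally show "((\<lambda>x. G x / x - x * I x) has_real_derivative - G y / y\<^sup>2) (at y)" .
    show "- G y / y\<^sup>2 \<le> 0" using G_bounds[OF y(1)] by simp
  next
    have "((\<lambda>x. x * I x) \<longlongrightarrow> 0) at_top"
      by (rule tendsto_sandwich[OF _ _ tendsto_const G_powr_lim[of k]])
         (use k I_bounds a in \<open>auto intro!: eventually_tailI\<close>)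
    moreover have "((\<lambda>x. G x / x) \<longlongrightarrow> 0) at_top"
      using tendsto_mult[OF G_lim tendsto_inverse_0_at_top[OF filterlim_ident]] by (simp add: divide_inverse)
    ultimately show "((\<lambda>x. G x / x - x * I x) \<longlongrightarrow> 0) at_top"
      using tendsto_diff[of "\<lambda>x. G x / x" 0 at_top "\<lambda>x. x * I x" 0] by simp
  qed
  then show ?thesis by (simp add: f_def)
qed

definition p :: "real \<Rightarrow> real" where "p x = x * G x powr (k - 1)"

lemma p_pos: "a \<le> x \<Longrightarrow> 0 < p x" using G_pos[of x] a by (simp add: p_def)

text \<open>
  Let \<open>r = G powr (1 - k) = x / p\<close>. Then \<open>r' = (k - 1) * G powr (- k) * f \<le> k - 1\<close>, so \<open>r\<close> grows at
  most linearly.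
\<close>

lemma p_lower: "\<forall>\<^sub>F x in at_top. 1 / k \<le> p x"
proof -
  define r where "r x = G x powr (1 - k)" for x
  define C where "C = r a - (k - 1) * a"
  have *: "r x \<le> (k - 1) * x + C" if "a \<le> x" for x
  proof -
    have "r x - (k - 1) * x \<le> r a - (k - 1) * a"
    proof (rule DERIV_nonpos_decreasing[OF that])
      fix y assume y: "a \<le> y"
      show "((\<lambda>x. r x - (k - 1) * x) has_real_derivative
         (- ((1 - k) * G y powr (1 - k - 1) * f y) - (k - 1) * 1)) (at y)"
        unfolding r_def by (rule DERIV_diff DERIV_G_powr y DERIV_cmult DERIV_ident)+
      have "G y powr (1 - k - 1) * f y \<le> 1"
        using f_bounds[OF y] G_pos[OF y] by (simp add: powr_minus field_simps)
      then show "(- ((1 - k) * G y powr (1 - k - 1) * f y) - (k - 1) * 1) \<le> 0"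
        using mult_left_mono[of "G y powr (1 - k - 1) * f y" 1 "k - 1"] k by (simp add: algebra_simps)
    qed
    then show ?thesis by (simp add: C_def)
  qed
  show ?thesis using eventually_ge_a eventually_ge_at_top[of C]
  proof eventually_elim
    case (elim x)
    then have "r x \<le> k * x" using * by (force simp: algebra_simps)
    then show ?case using G_pos[OF elim(1)] k
      by (simp add: p_def r_def powr_diff field_simps)
  qed
qed

lemma powr_diff_1: "0 < x \<Longrightarrow> x powr (e - 1) = x powr e / x" for x e :: real
  by (simp add: powr_diff)

text \<open>
  For the same \<open>r\<close>, \<open>f_lower\<close> gives \<open>r' \<ge> (k - 1) * (1 - r / x)\<close>. With the integrating factor
  \<open>x powr (k - 1)\<close> this reads \<open>(r * x powr (k - 1))' \<ge> (k - 1) * x powr (k - 1)\<close>, so \<open>r\<close> is at least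
  about \<open>(k - 1) / k * x\<close>; the constant of integration is absorbed by giving up a factor 2.
\<close>

lemma p_upper: "\<forall>\<^sub>F x in at_top. p x \<le> 2 * k / (k - 1)"
proof -
  define r where "r x = G x powr (1 - k)" for x
  define C where "C = r a * a powr (k - 1) - (k - 1) / k * a powr k"
  have *: "(k - 1) / k * x powr k + C \<le> r x * x powr (k - 1)" if "a \<le> x" for x
  proof -
    have "r a * a powr (k - 1) - (k - 1) / k * a powr k \<le> r x * x powr (k - 1) - (k - 1) / k * x powr k"
    proof (rule DERIV_nonneg_increasing[OF that])
      fix y assume y: "a \<le> y"
      then have y0: "0 < y" using a by simp
      let ?D = "- ((1 - k) * G y powr (1 - k - 1) * f y) * y powr (k - 1) +
           ((k - 1) * y powr (k - 1 - 1)) * r y - (k - 1) / k * (k * y powr (k - 1))"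
      show "((\<lambda>x. r x * x powr (k - 1) - (k - 1) / k * x powr k) has_real_derivative ?D) (at y)"
        unfolding r_def
        by (rule DERIV_diff DERIV_mult DERIV_G_powr y DERIV_cmult has_real_derivative_powr y0)+
      show "0 \<le> ?D"
      proof -
        have "(G y powr k - G y / y) * G y powr (- k) \<le> f y * G y powr (-k)"
          using f_lower[OF y] by (intro mult_right_mono) auto
        then have "1 - r y / y \<le> G y powr (- k) * f y"
          using G_pos[OF y] y0 by (simp add: r_def powr_diff powr_minus field_simps)
        then have "(k - 1) * y powr (k - 1) * (1 - r y / y) \<le> (k - 1) * y powr (k - 1) * (G y powr (- k) * f y)"
          using k by (intro mult_left_mono) auto
        moreover have "?D = (k - 1) * y powr (k - 1) * (G y powr (- k) * f y) - (k - 1) * y powr (k - 1) * (1 - r y / y)"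
        proof -
          have "y powr (k - 1 - 1) = y powr (k - 1) / y" by (rule powr_diff_1[OF y0])
          moreover have "G y powr (1 - k - 1) = G y powr (- k)" by simp
          moreover have "(k - 1) / k * (k * y powr (k - 1)) = (k - 1) * y powr (k - 1)" using k by simp
          ultimately show ?thesis by (simp only:) (simp add: algebra_simps add_divide_distrib diff_divide_distrib)
        qed
        ultimately show ?thesis by linarith
      qed
    qed
    then show ?thesis by (simp add: C_def)
  qed
  have "\<forall>\<^sub>F x in at_top. \<bar>C\<bar> * (2 * k / (k - 1)) < x powr k"
    using eventually_ge_at_top[of 1] eventually_gt_at_top[of "\<bar>C\<bar> * (2 * k / (k - 1))"]
  proof eventually_elim
    case (elim x)
    then show ?case using powr_mono[of 1 k x] k by simp
  qed
  then show ?thesis using eventually_ge_a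
  proof eventually_elim
    case (elim x)
    then have x: "0 < x" using a by simp
    have "- C \<le> \<bar>C\<bar>" by simp
    also have "\<dots> \<le> (k - 1) / (2 * k) * x powr k" using elim k by (simp add: field_simps)
    finally have "- C \<le> (k - 1) / (2 * k) * x powr k" .
    then have "(k - 1) / (2 * k) * x powr k \<le> r x * x powr (k - 1)"
      using *[OF elim(2)] k by (simp add: field_simps)
    then have "(k - 1) / (2 * k) * x * x powr (k - 1) \<le> r x * x powr (k - 1)"
      using x powr_diff_1[OF x, of k] by simp
    then have "(k - 1) / (2 * k) * x \<le> r x"
      using x by (subst (asm) mult_le_cancel_right) auto
    then have "(k - 1) / (2 * k) * x * p x \<le> r x * p x"
      using p_pos[OF elim(2)] by (intro mult_right_mono) auto
    also have "r x * p x = x"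
      using G_pos[OF elim(2)] by (simp add: r_def p_def flip: powr_add)
    finally have "x * ((k - 1) / (2 * k) * p x) \<le> x * 1" by (simp add: mult_ac)
    then have "(k - 1) / (2 * k) * p x \<le> 1" using x by (subst (asm) mult_le_cancel_left) auto
    then show ?case using k by (simp add: field_simps)
  qed
qed

definition R :: "real \<Rightarrow> real" where "R x = f x / (x * G x powr (2 * k - 1))"

text \<open>
  The first half of the iteration step. The function differentiated here tends to 0, so the sign of
  \<open>p - P\<close> decides its sign, that is, whether \<open>R\<close> lies above or below \<open>k / ((2 * k - 1) * P)\<close>.
\<close>

lemma R_bound_deriv:
  assumes "a \<le> x" "P \<noteq> 0"
  shows "((\<lambda>x. f x / x - k / ((2 * k - 1) * P) * G x powr (2 * k - 1)) has_real_derivative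
     (k * f x * G x powr (k - 1) / (x * P) * (p x - P))) (at x)"
proof -
  have x: "0 < x" using assms a by simp
  have "((\<lambda>x. f x / x - k / ((2 * k - 1) * P) * G x powr (2 * k - 1)) has_real_derivative
     - (k * G x powr (k - 1) * f x / x) - k / ((2 * k - 1) * P) * - ((2 * k - 1) * G x powr (2 * k - 1 - 1) * f x)) (at x)"
    by (rule DERIV_diff DERIV_f_over_x DERIV_cmult DERIV_G_powr assms)+
  also have "k / ((2 * k - 1) * P) * - ((2 * k - 1) * G x powr (2 * k - 1 - 1) * f x) =
      - (k / P * G x powr (2 * k - 1 - 1) * f x)"
  proof -
    have "2 * k - 1 \<noteq> 0" using k by simp
    then show ?thesis by simp
  qed
  also have "G x powr (2 * k - 1 - 1) = G x powr (k - 1) * G x powr (k - 1)"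
    by (simp flip: powr_add)
  also have "- (k * G x powr (k - 1) * f x / x) - - (k / P * (G x powr (k - 1) * G x powr (k - 1)) * f x) =
    (k * f x * G x powr (k - 1) / (x * P) * (p x - P))"
    using x assms(2) by (simp add: p_def field_simps)
  finally show ?thesis .
qed

lemma R_bound_lim: "((\<lambda>x. f x / x - c * G x powr (2 * k - 1)) \<longlongrightarrow> 0) at_top"
proof -
  have "(f \<longlongrightarrow> 0) at_top"
    by (rule tendsto_sandwich[OF _ _ tendsto_const G_powr_lim[of k]])
       (use k f_bounds in \<open>auto intro!: eventually_tailI\<close>)
  then have "((\<lambda>x. f x * inverse x) \<longlongrightarrow> 0 * 0) at_top"
    by (intro tendsto_mult tendsto_inverse_0_at_top[OF filterlim_ident])
  then have "((\<lambda>x. f x / x - c * G x powr (2 * k - 1)) \<longlongrightarrow> 0 * 0 - c * 0) at_top"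
    unfolding divide_inverse using k by (intro tendsto_diff tendsto_mult_left G_powr_lim) auto
  then show ?thesis by simp
qed

lemma R_ge:
  assumes P: "0 < P" "\<forall>\<^sub>F x in at_top. p x \<le> P"
  shows "\<forall>\<^sub>F x in at_top. k / ((2 * k - 1) * P) \<le> R x"
proof -
  obtain b where b: "\<And>x. b \<le> x \<Longrightarrow> p x \<le> P" using P(2) by (auto simp: eventually_at_top_linorder)
  show ?thesis using eventually_ge_a eventually_ge_at_top[of b]
  proof eventually_elim
    case (elim x)
    then have x: "0 < x" using a by simp
    have "0 \<le> f x / x - k / ((2 * k - 1) * P) * G x powr (2 * k - 1)"
    proof (rule nonneg_of_antimono_tendsto_0[OF R_bound_deriv _ R_bound_lim])
      fix y assume "x \<le> y"
      then have y: "a \<le> y" "0 < y" "p y \<le> P" using elim a b by auto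
      then show "k * f y * G y powr (k - 1) / (y * P) * (p y - P) \<le> 0"
        using P f_bounds[OF y(1)] k by (intro mult_nonneg_nonpos) auto
    qed (use elim P in auto)
    then show ?case unfolding R_def using x G_pos[OF elim(1)] by (simp add: field_simps)
  qed
qed

lemma R_le:
  assumes P: "0 < P" "\<forall>\<^sub>F x in at_top. P \<le> p x"
  shows "\<forall>\<^sub>F x in at_top. R x \<le> k / ((2 * k - 1) * P)"
proof -
  obtain b where b: "\<And>x. b \<le> x \<Longrightarrow> P \<le> p x" using P(2) by (auto simp: eventually_at_top_linorder)
  show ?thesis using eventually_ge_a eventually_ge_at_top[of b]
  proof eventually_elim
    case (elim x)
    then have x: "0 < x" using a by simp
    have "0 \<le> - (f x / x - k / ((2 * k - 1) * P) * G x powr (2 * k - 1))"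
    proof (rule nonneg_of_antimono_tendsto_0[OF DERIV_minus[OF R_bound_deriv]])
      fix y assume "x \<le> y"
      then have y: "a \<le> y" "0 < y" "P \<le> p y" using elim a b by auto
      then show "- (k * f y * G y powr (k - 1) / (y * P) * (p y - P)) \<le> 0"
        using P f_bounds[OF y(1)] k by simp
    next
      show "((\<lambda>x. - (f x / x - k / ((2 * k - 1) * P) * G x powr (2 * k - 1))) \<longlongrightarrow> 0) at_top"
        using tendsto_minus[OF R_bound_lim] by (simp only: minus_zero)
    qed (use elim P in auto)
    then show ?case unfolding R_def using x G_pos[OF elim(1)] by (simp add: field_simps)
  qed
qed

text \<open>
  The second half of the iteration step: a bound on \<open>R\<close> makes
  \<open>x\<^sup>2 - G powr (2 - 2 * k) / (m * (k - 1))\<close> monotone, hence bounded on one side; multiplication by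
  \<open>G powr (2 * k - 2)\<close>, which tends to 0, leaves \<open>p\<^sup>2 - 1 / (m * (k - 1))\<close> with a vanishing error.
\<close>

lemma square_deriv:
  assumes "a \<le> x" "m \<noteq> 0"
  shows "((\<lambda>x. x\<^sup>2 - 1 / (m * (k - 1)) * G x powr (2 - 2 * k)) has_real_derivative
    (2 * x / m * (m - R x))) (at x)"
proof -
  have x: "0 < x" using assms a by simp
  have "((\<lambda>x. x\<^sup>2 - 1 / (m * (k - 1)) * G x powr (2 - 2 * k)) has_real_derivative
    2 * x - 1 / (m * (k - 1)) * - ((2 - 2 * k) * G x powr (2 - 2 * k - 1) * f x)) (at x)"
    by (rule DERIV_diff DERIV_cmult DERIV_G_powr assms derivative_eq_intros refl)+ auto
  also have "1 / (m * (k - 1)) * - ((2 - 2 * k) * G x powr (2 - 2 * k - 1) * f x) = 2 / m * (G x powr (2 - 2 * k - 1) * f x)"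
    using k assms(2) by (simp add: field_simps)
  also have "G x powr (2 - 2 * k - 1) = inverse (G x powr (2 * k - 1))" by (simp flip: powr_minus)
  also have "2 * x - 2 / m * (inverse (G x powr (2 * k - 1)) * f x) = 2 * x / m * (m - R x)"
    using x assms(2) G_pos[OF assms(1)] by (simp add: R_def field_simps)
  finally show ?thesis .
qed

lemma p_square: "a \<le> x \<Longrightarrow> (p x)\<^sup>2 = x\<^sup>2 * G x powr (2 * k - 2)"
  by (simp add: p_def power_mult_distrib power2_eq_square flip: powr_add)

text \<open>
  The factor \<open>S\<close> will be \<open>1\<close> or \<open>- 1\<close>, so that upper and lower bounds are treated together.
\<close>

lemma p_square_close:
  assumes "0 < m" "0 < e" and S: "\<And>x. b \<le> x \<Longrightarrow> S * (x\<^sup>2 - 1 / (m * (k - 1)) * G x powr (2 - 2 * k)) \<le> C"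
  shows "\<forall>\<^sub>F x in at_top. S * ((p x)\<^sup>2 - 1 / (m * (k - 1))) \<le> e"
proof -
  have "((\<lambda>x. C * G x powr (2 * k - 2)) \<longlongrightarrow> C * 0) at_top"
    using k by (intro tendsto_mult tendsto_const G_powr_lim) auto
  then have "\<forall>\<^sub>F x in at_top. C * G x powr (2 * k - 2) < e"
    using assms(2) by (intro order_tendstoD) auto
  then show ?thesis using eventually_ge_a eventually_ge_at_top[of b]
  proof eventually_elim
    case (elim x)
    have inv: "G x powr (2 - 2 * k) * G x powr (2 * k - 2) = 1"
      using G_pos[OF elim(2)] by (simp flip: powr_add)
    have "S * (x\<^sup>2 - 1 / (m * (k - 1)) * G x powr (2 - 2 * k)) * G x powr (2 * k - 2) \<le> C * G x powr (2 * k - 2)"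
      using S elim by (intro mult_right_mono) auto
    also have "S * (x\<^sup>2 - 1 / (m * (k - 1)) * G x powr (2 - 2 * k)) * G x powr (2 * k - 2) =
      S * ((p x)\<^sup>2 - 1 / (m * (k - 1)) * (G x powr (2 - 2 * k) * G x powr (2 * k - 2)))"
      unfolding p_square[OF elim(2)] by (simp add: algebra_simps)
    finally show ?case using elim inv by simp
  qed
qed

lemma p_square_le:
  assumes m: "0 < m" "\<forall>\<^sub>F x in at_top. m \<le> R x" and e: "0 < e"
  shows "\<forall>\<^sub>F x in at_top. (p x)\<^sup>2 \<le> 1 / (m * (k - 1)) + e"
proof -
  obtain b where b: "a \<le> b" "\<And>x. b \<le> x \<Longrightarrow> m \<le> R x"
    using eventually_conj[OF eventually_ge_a m(2)] by (auto simp: eventually_at_top_linorder)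
  define h where "h x = x\<^sup>2 - 1 / (m * (k - 1)) * G x powr (2 - 2 * k)" for x
  have "1 * h x \<le> h b" if "b \<le> x" for x
    unfolding mult_1
    unfolding h_def
  proof (rule DERIV_nonpos_decreasing[OF that square_deriv])
    show "2 * y / m * (m - R y) \<le> 0" if "b \<le> y" for y
      using b that m(1) a by (intro mult_nonneg_nonpos) auto
  qed (use b m in auto)
  from p_square_close[OF m(1) e, where S = 1, OF this[unfolded h_def]] show ?thesis
    by (rule eventually_mono) auto
qed

lemma p_square_ge:
  assumes m: "0 < m" "\<forall>\<^sub>F x in at_top. R x \<le> m" and e: "0 < e"
  shows "\<forall>\<^sub>F x in at_top. 1 / (m * (k - 1)) - e \<le> (p x)\<^sup>2"
proof -
  obtain b where b: "a \<le> b" "\<And>x. b \<le> x \<Longrightarrow> R x \<le> m"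
    using eventually_conj[OF eventually_ge_a m(2)] by (auto simp: eventually_at_top_linorder)
  define h where "h x = x\<^sup>2 - 1 / (m * (k - 1)) * G x powr (2 - 2 * k)" for x
  have "h b \<le> h x" if "b \<le> x" for x
    unfolding h_def
  proof (rule DERIV_nonneg_increasing[OF that square_deriv])
    show "0 \<le> 2 * y / m * (m - R y)" if "b \<le> y" for y
      using b that m(1) a by (intro mult_nonneg_nonneg) auto
  qed (use b m in auto)
  then have "(- 1) * h x \<le> - h b" if "b \<le> x" for x using that by simp
  from p_square_close[OF m(1) e, where S = "-1", OF this[unfolded h_def]] show ?thesis
    by (rule eventually_mono) auto
qed

definition L :: real where "L = (2 * k - 1) / (k * (k - 1))"

lemma L_pos: "0 < L" using k by (simp add: L_def)

lemma p_lim: "(p \<longlongrightarrow> L) at_top"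
proof (rule tendsto_of_sqrt_contraction[OF L_pos _ p_lower p_upper])
  have *: "1 / (k / ((2 * k - 1) * P) * (k - 1)) = L * P" for P by (simp add: L_def)
  have pos: "0 < k / ((2 * k - 1) * P)" if "0 < P" for P using k that by simp
  show "\<forall>\<^sub>F x in at_top. (p x)\<^sup>2 \<le> L * P + e" if "0 < P" "0 < e" "\<forall>\<^sub>F x in at_top. p x \<le> P" for P e
    using p_square_le[OF pos[OF that(1)] R_ge[OF that(1,3)] that(2)] by (simp only: *)
  show "\<forall>\<^sub>F x in at_top. L * P - e \<le> (p x)\<^sup>2" if "0 < P" "0 < e" "\<forall>\<^sub>F x in at_top. P \<le> p x" for P e
    using p_square_ge[OF pos[OF that(1)] R_le[OF that(1,3)] that(2)] by (simp only: *)
qed (use k in auto)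

text \<open>
  Since \<open>p\<close> is eventually below every \<open>P > L\<close> and above every \<open>P < L\<close>, the bounds \<open>R_ge\<close> and \<open>R_le\<close>
  squeeze \<open>R\<close>; continuity of \<open>P \<mapsto> k / ((2 * k - 1) * P)\<close> at \<open>L\<close> lets \<open>P\<close> approach \<open>L\<close>.
\<close>

lemma R_lim: "(R \<longlongrightarrow> k / ((2 * k - 1) * L)) at_top"
proof (rule order_tendstoI)
  define \<phi> where "\<phi> P = k / ((2 * k - 1) * P)" for P
  have c: "isCont \<phi> L" unfolding \<phi>_def using k L_pos by (intro continuous_intros) auto
  then have right: "(\<phi> \<longlongrightarrow> \<phi> L) (at_right L)" and left: "(\<phi> \<longlongrightarrow> \<phi> L) (at_left L)"
    by (auto simp: isCont_def filterlim_at_split)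
  show "\<forall>\<^sub>F x in at_top. y < R x" if "y < k / ((2 * k - 1) * L)" for y
  proof -
    have "\<forall>\<^sub>F P in at_right L. y < \<phi> P \<and> L < P"
      using order_tendstoD(1)[OF right, of y] that
      by (intro eventually_conj eventually_at_right_less) (auto simp: \<phi>_def)
    then obtain P where P: "y < \<phi> P" "L < P" using eventually_happens'[OF trivial_limit_at_right_real] by blast
    then have "\<forall>\<^sub>F x in at_top. p x \<le> P"
      using order_tendstoD(2)[OF p_lim P(2)] by (auto elim: eventually_mono)
    from R_ge[OF _ this] show ?thesis
      using P L_pos by (auto simp: \<phi>_def elim: eventually_mono)
  qed
  show "\<forall>\<^sub>F x in at_top. R x < y" if "k / ((2 * k - 1) * L) < y" for y
  proof -
    have "\<forall>\<^sub>F P in at_left L. \<phi> P < y \<and> P < L \<and> 0 < P"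
      using order_tendstoD(2)[OF left, of y] that eventually_at_left_real[OF L_pos]
      by (auto simp: \<phi>_def elim: eventually_elim2)
    then obtain P where P: "\<phi> P < y" "P < L" "0 < P" using eventually_happens'[OF trivial_limit_at_left_real] by blast
    then have "\<forall>\<^sub>F x in at_top. P \<le> p x"
      using order_tendstoD(1)[OF p_lim P(2)] by (auto elim: eventually_mono)
    from R_le[OF _ this] show ?thesis
      using P by (auto simp: \<phi>_def elim: eventually_mono)
  qed
qed

lemma G_asymp: "G \<sim>[at_top] (\<lambda>x. L powr (1 / (k - 1)) / x powr (1 / (k - 1)))"
proof (rule asymp_equivI')
  have "((\<lambda>x. (p x / L) powr (1 / (k - 1))) \<longlongrightarrow> (L / L) powr (1 / (k - 1))) at_top"
    using L_pos by (intro tendsto_intros p_lim) auto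
  moreover have "\<forall>\<^sub>F x in at_top. (p x / L) powr (1 / (k - 1)) = G x / (L powr (1 / (k - 1)) / x powr (1 / (k - 1)))"
    using eventually_ge_a
  proof eventually_elim
    case (elim x)
    then show ?case using G_pos[of x] a k L_pos by (simp add: p_def powr_divide powr_mult powr_powr)
  qed
  ultimately show "((\<lambda>x. G x / (L powr (1 / (k - 1)) / x powr (1 / (k - 1)))) \<longlongrightarrow> 1) at_top"
    using L_pos by (auto elim: Lim_transform_eventually)
qed

lemma f_asymp: "f \<sim>[at_top] (\<lambda>x. L powr (1 / (k - 1)) / ((k - 1) * x powr (1 + 1 / (k - 1))))"
proof -
  have "((\<lambda>x. (k - 1) * (R x * (p x)\<^sup>2)) \<longlongrightarrow> (k - 1) * (k / ((2 * k - 1) * L) * L\<^sup>2)) at_top"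
    by (intro tendsto_intros R_lim p_lim)
  also have "(k - 1) * (k / ((2 * k - 1) * L) * L\<^sup>2) = 1"
    using k L_pos by (simp add: power2_eq_square) (simp add: L_def field_simps)
  \<comment> \<open>by definition \<open>R * p\<^sup>2 = x * f / G\<close>\<close>
  also have "((\<lambda>x. (k - 1) * (R x * (p x)\<^sup>2)) \<longlongrightarrow> 1) at_top \<longleftrightarrow> ((\<lambda>x. f x / (G x / ((k - 1) * x))) \<longlongrightarrow> 1) at_top"
  proof (rule tendsto_cong, use eventually_ge_a in eventually_elim)
    case (elim x)
    have "G x powr (2 * k - 1) = G x * G x powr (2 * k - 2)"
      using G_pos[OF elim] by (simp add: powr_diff power2_eq_square)
    moreover have "0 < x" using elim a by simp
    ultimately show ?case
      using G_pos[OF elim] k by (simp add: p_square[OF elim] R_def) (simp add: power2_eq_square)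
  qed
  finally have "f \<sim>[at_top] (\<lambda>x. G x / ((k - 1) * x))" by (rule asymp_equivI')
  also have "(\<lambda>x. G x / ((k - 1) * x)) \<sim>[at_top] (\<lambda>x. L powr (1 / (k - 1)) / x powr (1 / (k - 1)) / ((k - 1) * x))"
    by (intro asymp_equiv_intros G_asymp)
  also have "\<dots> \<sim>[at_top] (\<lambda>x. L powr (1 / (k - 1)) / ((k - 1) * x powr (1 + 1 / (k - 1))))"
    by (rule asymp_equiv_refl_ev, use eventually_gt_at_top[of 0] in eventually_elim)
       (simp add: powr_add field_simps)
  finally show ?thesis .
qed

end

section \<open>The asymptotics of the profile\<close>

text \<open>
  The point masses at \<open>a \<ge> 1\<close> have weighted norm \<open>1 / a\<close>. In the absence of solutions they are
  attracting vacuously, so the attracting profile is not unique.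
\<close>

lemma attracting_profile_of_no_solution:
  assumes none: "evolution_solutions \<Psi> = {}" and a: "1 \<le> a"
  shows "attracting_profile \<Psi> (indicator {a..})"
proof -
  let ?H = "indicator {a..} :: real \<Rightarrow> real"
  interpret real_distribution "return borel a"
    by (simp add: real_distribution_def real_distribution_axioms_def prob_space_return)
  have cdf: "?H = cdf (return borel a)"
    by (auto simp: cdf_def measure_return fun_eq_iff indicator_def)
  have "integrable lborel (\<lambda>x. indicator {0..N} x *\<^sub>R ?H x)" for N
  proof -
    have "(\<lambda>x. indicator {0..N} x *\<^sub>R ?H x) = indicator {a..N}" using a by (auto simp: indicator_def)
    moreover have "integrable lborel (indicator {a..N} :: real \<Rightarrow> real)"
      by (rule integrable_real_indicator) (auto simp: emeasure_lborel_Icc_eq)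
    ultimately show ?thesis by simp
  qed
  then have "?H \<in> L1loc" using a by (auto simp: L1loc_def set_integrable_def)
  moreover have "mono_on {0..} ?H" by (auto simp: mono_on_def indicator_def)
  moreover have "continuous (at_right x) ?H" for x using cdf_is_right_cont[of x] by (simp add: cdf)
  moreover have "\<exists>l. (?H \<longlongrightarrow> l) (at_left x)" for x
  proof (cases "a < x")
    case True
    have "\<forall>\<^sub>F z in at_left x. ?H z = 1"
      using eventually_at_left_real[OF True] by eventually_elim auto
    then show ?thesis using tendsto_eventually by blast
  next
    case False
    have "\<forall>\<^sub>F z in at_left x. ?H z = 0"
      using False by (auto simp: eventually_at_filter intro: always_eventually)
    then show ?thesis using tendsto_eventually by blast
  qed
  ultimately have "?H \<in> cadlag_D" by (auto simp: cadlag_D_def indicator_def)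
  moreover have "wnorm ?H \<le> 1"
  proof -
    have "wnorm ?H = (\<integral>\<^sup>+w. ennreal (indicator {a<..} w * (1 / w\<^sup>2)) \<partial>lborel)"
      unfolding wnorm_def
      by (intro nn_integral_cong_AE, use AE_lborel_singleton[of a] in eventually_elim)
         (use a in \<open>auto simp: indicator_def\<close>)
    also have "\<dots> = ennreal (1 / a)"
      using has_bochner_integral_inverse_square[of a] a
      by (subst nn_integral_eq_integral) (auto simp: has_bochner_integral_iff indicator_def)
    also have "\<dots> \<le> 1" using a by simp
    finally show ?thesis .
  qed
  moreover have "distribution_function ?H"
    unfolding distribution_function_def using a
    by (intro exI[of _ "return borel a"] conjI cdf real_distribution_axioms) (auto simp: measure_return)
  ultimately show ?thesis using none by (simp add: attracting_profile_def cadlag_D1_def)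
qed

lemma obtain_solution:
  assumes "is_F_Psi \<Psi> F" obtains X where "X \<in> evolution_solutions \<Psi>"
proof -
  have "evolution_solutions \<Psi> \<noteq> {}"
  proof
    assume "evolution_solutions \<Psi> = {}"
    then have "attracting_profile \<Psi> (indicator {1..})" "attracting_profile \<Psi> (indicator {2..})"
      by (auto intro: attracting_profile_of_no_solution)
    then have "indicator {1..} = F" "indicator {2..} = F" using assms by (auto simp: is_F_Psi_def)
    then have "indicator {1..} (1::real) = (indicator {2::real..} 1 :: real)" by metis
    then show False by simp
  qed
  then show ?thesis using that by blast
qed

theorem proposition9p4:
  fixes k c :: real and \<Psi> F :: "real \<Rightarrow> real"
  assumes "k > 1"
    and "\<And>u. u \<in> {0..1} \<Longrightarrow> \<Psi> u = 1 - (1 - u) powr k"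
    and "is_F_Psi \<Psi> F"
    and "c = ((2 * k - 1) / (k * (k - 1))) powr (1 / (k - 1))"
  shows "(\<lambda>x. 1 - F x) \<sim>[at_top] (\<lambda>x. c / x powr (1 / (k - 1))) \<and>
         deriv F \<sim>[at_top] (\<lambda>x. c / ((k - 1) * x powr (1 + 1 / (k - 1))))"
proof -
  obtain X where X: "X \<in> evolution_solutions \<Psi>" using obtain_solution[OF assms(3)] .
  have F: "attracting_profile \<Psi> F" using assms(3) by (simp add: is_F_Psi_def)
  interpret attracted_solution k \<Psi> X F
    using assms(1,2) X F by unfold_locales (auto simp: attracting_profile_def cadlag_D1_def)
  obtain M where M: "real_distribution M" "F = cdf M"
    using F by (auto simp: attracting_profile_def distribution_function_def)
  have "(F \<longlongrightarrow> 1) at_top"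
    using real_distribution.cdf_lim_at_top_prob[OF M(1)] M(2) by simp
  then have G_lim: "((\<lambda>x. 1 - F x) \<longlongrightarrow> 1 - 1) at_top" by (intro tendsto_intros)
  \<comment> \<open>otherwise the norm of \<open>F\<close> on \<open>{1 / 8<..<1 / 4}\<close> alone would be at least 2\<close>
  have "F (1 / 8) < 1"
  proof (rule ccontr)
    assume "\<not> F (1 / 8) < 1"
    then have "ennreal (1 * (1 / 4 - 1 / 8) / (1 / 4)\<^sup>2) \<le> wnorm F"
    proof (intro wnorm_ge)
      fix w :: real assume "1 / 8 < w"
      then show "1 \<le> \<bar>F w\<bar>" if "\<not> F (1 / 8) < 1" using F_mono[of "1 / 8" w] that by linarith
    qed auto
    also have "\<dots> \<le> 1" using F by (simp add: attracting_profile_def cadlag_D1_def)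
    finally show False by (simp add: power2_eq_square)
  qed
  interpret profile_tail k "1 / 8" "\<lambda>x. 1 - F x" J
  proof
    fix x :: real assume "1 / 8 \<le> x"
    then have x: "0 < x" by simp
    show "0 \<le> J x \<and> x * J x \<le> (1 - F x) powr k"
      using survival.tail_bounds[OF survival_U x] by (simp add: J_def U_def)
    show "((\<lambda>x. 1 - F x) has_real_derivative - ((1 - F x) powr k - x * J x)) (at x)"
      using DERIV_diff[OF DERIV_const DERIV_F[OF x], of 1] by (simp add: flux_U U_def)
    show "(J has_real_derivative - ((1 - F x) powr k / x\<^sup>2)) (at x)"
      using DERIV_J[OF x] by (simp add: U_def)
  qed (use k \<open>F (1 / 8) < 1\<close> F_bounds G_lim in auto)
  have c: "L powr (1 / (k - 1)) = c" by (simp add: L_def assms(4))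
  have "deriv F x = f x" if "1 / 8 \<le> x" for x
    using DERIV_F[of x] that by (intro DERIV_imp_deriv) (simp add: flux_U U_def f_def)
  then have ev: "\<forall>\<^sub>F x in at_top. f x = deriv F x" by (intro eventually_tailI) simp
  have "deriv F \<sim>[at_top] (\<lambda>x. c / ((k - 1) * x powr (1 + 1 / (k - 1))))"
    using f_asymp unfolding c by (rule asymp_equiv_cong[OF ev always_eventually, THEN iffD1, rotated]) simp
  then show ?thesis using G_asymp by (simp add: c)
qed

end
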